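(* Let $\mathbf K$ be a field and let $\mathsf{Ins}$ be the operad in the category of $\mathbf K$-vector spaces defined by the following generators and relations: its algebras are the unital associative algebras $(\Lambda,\mu,\upsilon_0)$ endowed with further arity zero operations $\upsilon_n:\mathbf K\to\Lambda$ for every $n\geq 1$, and with an arity one operation $I_\lambda:\Lambda\to\Lambda$ for every non-zero finitely supported sequence $\lambda=(\lambda_n)_{n\in\mathbb N}$ of elements of $\mathbf K$, subject to the relation $$\mu\circ\Big(\sum_{n\in\mathbb N}\lambda_n\upsilon_n\otimes \mathrm{id}_\Lambda\Big)\circ I_\lambda=\mathrm{id}_\Lambda$$ for every such $\lambda$. Then $\mathsf{Ins}\neq 0$, but every $\mathsf{Ins}$-coalgebra is zero; in other terms, the comonad on $\mathbf K$-vector spaces associated with the cofree $\mathsf{Ins}$-coalgebra functor is the zero comonad.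
   Context: Operads are (symmetric, unital) operads in the symmetric monoidal category of $\mathbf K$-vector spaces. Here $\mathbb N$ contains $0$, and in the relation $\mathbf K\otimes\Lambda$ is identified with $\Lambda$. A coalgebra over an operad $P$ is a vector space $V$ together with a morphism of operads $P\to \mathrm{Coend}_V$, where $\mathrm{Coend}_V(n)=\mathrm{Hom}(V,V^{\otimes n})$ with the evident right $\mathbf S_n$-action and compositions; equivalently, it is given by maps $P(n)\otimes V\to V^{\otimes n}$ that are suitably associative, unital and equivariant. Thus an $\mathsf{Ins}$-coalgebra is a counital coassociative coalgebra $(V,\delta,\varepsilon_0)$ with linear forms $\varepsilon_n:V\to\mathbf K$ for $n\geq1$ and linear maps $I_\lambda:V\to V$ such that $I_\lambda\circ\big(\sum_{n}\lambda_n\varepsilon_n\otimes\mathrm{id}_V\big)\circ\delta=\mathrm{id}_V$ for every non-zero finitely supported $\lambda$. The comonad associated with $P$ is the one induced by the adjunction between the forgetful functor from $P$-coalgebras to vector spaces and its right adjoint, the cofree $P$-coalgebra functor. *)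

theory Defs
  imports
    "HOL-Algebra.Module"
    "HOL-Algebra.AbelCoset"
    "HOL-Decision_Procs.Algebra_Aux"
    "HOL-Library.Poly_Mapping"
    "HOL-Combinatorics.Permutations"
begin

section \<open>Vector spaces\<close>

text \<open>
  The ground field is a type of class \<^class>\<open>field\<close>. Vector spaces are modules (in the sense of
  HOL-Algebra) with an explicit carrier over this field; the carrier may be a subset of any type.
  The multiplicative fields of the module record are irrelevant.
\<close>

abbreviation vector_space_on :: "('k::field, 'v) module \<Rightarrow> bool" where
  "vector_space_on V \<equiv> module (cring_class_ops :: 'k ring) V"

abbreviation subspace_of :: "'v set \<Rightarrow> ('k::field, 'v) module \<Rightarrow> bool" where
  "subspace_of S V \<equiv> submodule S (cring_class_ops :: 'k ring) V"

definition is_zero_space :: "('k, 'v) module \<Rightarrow> bool" where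
  "is_zero_space V \<longleftrightarrow> carrier V = {\<zero>\<^bsub>V\<^esub>}"

definition subspace_span :: "('k::field, 'v) module \<Rightarrow> 'v set \<Rightarrow> 'v set" where
  "subspace_span V A = \<Inter>{S. subspace_of S V \<and> A \<subseteq> S}"

text \<open>Linear maps are taken extensional, so that they are determined by their values on the
  carrier.\<close>

definition linear_maps :: "('k, 'v) module \<Rightarrow> ('k, 'w) module \<Rightarrow> ('v \<Rightarrow> 'w) set" where
  "linear_maps V W = {f \<in> carrier V \<rightarrow>\<^sub>E carrier W.
     (\<forall>x\<in>carrier V. \<forall>y\<in>carrier V. f (x \<oplus>\<^bsub>V\<^esub> y) = f x \<oplus>\<^bsub>W\<^esub> f y) \<and>
     (\<forall>c. \<forall>x\<in>carrier V. f (c \<odot>\<^bsub>V\<^esub> x) = c \<odot>\<^bsub>W\<^esub> f x)}"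

definition zero_map :: "('k, 'v) module \<Rightarrow> ('k, 'w) module \<Rightarrow> 'v \<Rightarrow> 'w" where
  "zero_map V W = (\<lambda>v\<in>carrier V. \<zero>\<^bsub>W\<^esub>)"

definition hom_space :: "('k, 'v) module \<Rightarrow> ('k, 'w) module \<Rightarrow> ('k, 'v \<Rightarrow> 'w) module" where
  "hom_space V W = \<lparr>carrier = linear_maps V W, monoid.mult = undefined, one = undefined,
     zero = zero_map V W,
     add = (\<lambda>f g. \<lambda>v\<in>carrier V. f v \<oplus>\<^bsub>W\<^esub> g v),
     smult = (\<lambda>c f. \<lambda>v\<in>carrier V. c \<odot>\<^bsub>W\<^esub> f v)\<rparr>"

definition free_space :: "'x set \<Rightarrow> ('k::field, 'x \<Rightarrow>\<^sub>0 'k) module" where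
  "free_space X = \<lparr>carrier = {f. Poly_Mapping.keys f \<subseteq> X}, monoid.mult = undefined, one = undefined,
     zero = 0, add = (+), smult = (\<lambda>c. Poly_Mapping.map ((*) c))\<rparr>"

definition quotient_space :: "('k, 'v) module \<Rightarrow> 'v set \<Rightarrow> ('k, 'v set) module" where
  "quotient_space V S = \<lparr>carrier = a_rcosets\<^bsub>V\<^esub> S, monoid.mult = undefined, one = undefined,
     zero = S, add = (<+>\<^bsub>V\<^esub>),
     smult = (\<lambda>c X. S <+>\<^bsub>V\<^esub> ((\<lambda>x. c \<odot>\<^bsub>V\<^esub> x) ` X))\<rparr>"

text \<open>
  A chosen representative of a coset. It is only used to define maps out of quotients by formulas
  that do not depend on the choice.
\<close>

definition repr :: "'v set \<Rightarrow> 'v" where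
  "repr X = (SOME x. x \<in> X)"

definition linear_ext :: "('a \<Rightarrow> 'b) \<Rightarrow> ('a \<Rightarrow>\<^sub>0 'k::field) \<Rightarrow> ('b \<Rightarrow>\<^sub>0 'k)" where
  "linear_ext F p = (\<Sum>t\<in>Poly_Mapping.keys p. Poly_Mapping.single (F t) (Poly_Mapping.lookup p t))"

definition multilinear_ext :: "('a list \<Rightarrow> 'b) \<Rightarrow> ('a \<Rightarrow>\<^sub>0 'k::field) list \<Rightarrow> ('b \<Rightarrow>\<^sub>0 'k)" where
  "multilinear_ext F ps =
     (\<Sum>ts\<in>listset (map Poly_Mapping.keys ps).
        Poly_Mapping.single (F ts) (prod_list (map2 Poly_Mapping.lookup ps ts)))"


section \<open>Tensor powers\<close>

definition tuples :: "('k, 'v) module \<Rightarrow> nat \<Rightarrow> 'v list set" where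
  "tuples V n = {vs. length vs = n \<and> set vs \<subseteq> carrier V}"

definition multilinear_relations :: "('k::field, 'v) module \<Rightarrow> nat \<Rightarrow> ('v list \<Rightarrow>\<^sub>0 'k) set" where
  "multilinear_relations V n =
     {Poly_Mapping.single (us @ (x \<oplus>\<^bsub>V\<^esub> y) # ws) 1
        - Poly_Mapping.single (us @ x # ws) 1 - Poly_Mapping.single (us @ y # ws) 1
      | us x y ws. us @ x # ws \<in> tuples V n \<and> y \<in> carrier V}
     \<union> {Poly_Mapping.single (us @ (c \<odot>\<^bsub>V\<^esub> x) # ws) 1 - Poly_Mapping.single (us @ x # ws) c
      | us c x ws. us @ x # ws \<in> tuples V n}"

definition tensor_kernel :: "('k::field, 'v) module \<Rightarrow> nat \<Rightarrow> ('v list \<Rightarrow>\<^sub>0 'k) set" where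
  "tensor_kernel V n = subspace_span (free_space (tuples V n)) (multilinear_relations V n)"

type_synonym ('k, 'v) tensor = "('v list \<Rightarrow>\<^sub>0 'k) set"

definition tensor_power :: "('k::field, 'v) module \<Rightarrow> nat \<Rightarrow> ('k, ('k, 'v) tensor) module" where
  "tensor_power V n = quotient_space (free_space (tuples V n)) (tensor_kernel V n)"

definition tensor_class ::
    "('k::field, 'v) module \<Rightarrow> nat \<Rightarrow> ('v list \<Rightarrow>\<^sub>0 'k) \<Rightarrow> ('k, 'v) tensor" where
  "tensor_class V n x = tensor_kernel V n +>\<^bsub>free_space (tuples V n)\<^esub> x"

definition pure_tensor :: "('k::field, 'v) module \<Rightarrow> 'v list \<Rightarrow> ('k, 'v) tensor" where
  "pure_tensor V vs = tensor_class V (length vs) (Poly_Mapping.single vs 1)"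

text \<open>
  For linear maps \<open>g\<^sub>i : V \<rightarrow> W\<^sup>\<otimes>\<^sup>n\<^sup>i\<close>, \<open>i < m\<close>, this is
  the map \<open>g\<^sub>0 \<otimes> \<dots> \<otimes> g\<^sub>m\<^sub>-\<^sub>1\<close> from the \<open>m\<close>-th tensor power of \<open>V\<close> to the tensor power of \<open>W\<close> of
  exponent \<open>sum_list ns\<close>; tensors are multiplied by concatenation.
\<close>

definition tensor_of_maps ::
    "('k::field, 'w) module \<Rightarrow> nat list \<Rightarrow> ('v \<Rightarrow> ('k, 'w) tensor) list
      \<Rightarrow> ('k, 'v) tensor \<Rightarrow> ('k, 'w) tensor" where
  "tensor_of_maps W ns gs X = tensor_class W (sum_list ns)
     (\<Sum>vs\<in>Poly_Mapping.keys (repr X). Poly_Mapping.map ((*) (Poly_Mapping.lookup (repr X) vs))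
        (multilinear_ext concat (map2 (\<lambda>g v. repr (g v)) gs vs)))"

definition tensor_power_map ::
    "('k::field, 'w) module \<Rightarrow> nat \<Rightarrow> ('v \<Rightarrow> 'w) \<Rightarrow> ('k, 'v) tensor \<Rightarrow> ('k, 'w) tensor" where
  "tensor_power_map W n f X = tensor_class W n (linear_ext (map f) (repr X))"

text \<open>
  The right action of a permutation \<open>\<sigma>\<close> sends
  \<open>v\<^sub>0 \<otimes> \<dots> \<otimes> v\<^sub>n\<^sub>-\<^sub>1\<close> to the tensor whose \<open>i\<close>-th factor is \<open>v\<^bsub>\<sigma> i\<^esub>\<close>.
\<close>

definition tensor_perm ::
    "('k::field, 'v) module \<Rightarrow> nat \<Rightarrow> (nat \<Rightarrow> nat) \<Rightarrow> ('k, 'v) tensor \<Rightarrow> ('k, 'v) tensor" where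
  "tensor_perm V n \<sigma> X =
     tensor_class V n (linear_ext (\<lambda>vs. map (\<lambda>i. vs ! \<sigma> i) [0..<n]) (repr X))"


section \<open>Operads\<close>

text \<open>
  The data of a symmetric unital operad: spaces \<open>P(n)\<close>, the identity in \<open>P(1)\<close>, the total
  compositions \<open>P(m) \<otimes> P(n\<^sub>0) \<otimes> \<dots> \<otimes> P(n\<^sub>m\<^sub>-\<^sub>1) \<rightarrow> P(n\<^sub>0 + \<dots> + n\<^sub>m\<^sub>-\<^sub>1)\<close>, indexed by the list
  \<open>[n\<^sub>0, \<dots>, n\<^sub>m\<^sub>-\<^sub>1]\<close>, and the right actions of the symmetric groups (permutations of \<open>{..<n}\<close>).
  The only operads below are free operads, their quotients by operadic ideals, and coendomorphism
  operads, for which the operad axioms hold by construction.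
\<close>

record ('k, 'p) operad =
  op_space :: "nat \<Rightarrow> ('k, 'p) module"
  op_id :: 'p
  op_comp :: "nat list \<Rightarrow> 'p \<Rightarrow> 'p list \<Rightarrow> 'p"
  op_act :: "nat \<Rightarrow> (nat \<Rightarrow> nat) \<Rightarrow> 'p \<Rightarrow> 'p"

definition is_zero_operad :: "('k, 'p) operad \<Rightarrow> bool" where
  "is_zero_operad P \<longleftrightarrow> (\<forall>n. is_zero_space (op_space P n))"

definition composable :: "('k, 'p) operad \<Rightarrow> nat list \<Rightarrow> 'p \<Rightarrow> 'p list \<Rightarrow> bool" where
  "composable P ns p qs \<longleftrightarrow> p \<in> carrier (op_space P (length ns)) \<and>
     list_all2 (\<lambda>n q. q \<in> carrier (op_space P n)) ns qs"

definition operad_morphism ::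
    "('k, 'p) operad \<Rightarrow> ('k, 'q) operad \<Rightarrow> (nat \<Rightarrow> 'p \<Rightarrow> 'q) \<Rightarrow> bool" where
  "operad_morphism P Q \<phi> \<longleftrightarrow>
     (\<forall>n. \<phi> n \<in> linear_maps (op_space P n) (op_space Q n)) \<and>
     \<phi> 1 (op_id P) = op_id Q \<and>
     (\<forall>ns p qs. composable P ns p qs \<longrightarrow>
        \<phi> (sum_list ns) (op_comp P ns p qs) = op_comp Q ns (\<phi> (length ns) p) (map2 \<phi> ns qs)) \<and>
     (\<forall>n \<sigma>. \<forall>p\<in>carrier (op_space P n). \<sigma> permutes {..<n} \<longrightarrow>
        \<phi> n (op_act P n \<sigma> p) = op_act Q n \<sigma> (\<phi> n p))"


subsection \<open>Operads presented by generators and relations\<close>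

definition operadic_ideal :: "('k::field, 'p) operad \<Rightarrow> (nat \<Rightarrow> 'p set) \<Rightarrow> bool" where
  "operadic_ideal P J \<longleftrightarrow>
     (\<forall>n. subspace_of (J n) (op_space P n)) \<and>
     (\<forall>ns p qs. composable P ns p qs \<and>
        (p \<in> J (length ns) \<or> (\<exists>i<length ns. qs ! i \<in> J (ns ! i))) \<longrightarrow>
        op_comp P ns p qs \<in> J (sum_list ns)) \<and>
     (\<forall>n \<sigma>. \<forall>p\<in>J n. \<sigma> permutes {..<n} \<longrightarrow> op_act P n \<sigma> p \<in> J n)"

definition ideal_generated_by ::
    "('k::field, 'p) operad \<Rightarrow> (nat \<Rightarrow> 'p set) \<Rightarrow> nat \<Rightarrow> 'p set" where
  "ideal_generated_by P R n = \<Inter>{J n | J. operadic_ideal P J \<and> (\<forall>m. R m \<subseteq> J m)}"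

definition quotient_operad ::
    "('k, 'p) operad \<Rightarrow> (nat \<Rightarrow> 'p set) \<Rightarrow> ('k, 'p set) operad" where
  "quotient_operad P J = \<lparr>
     op_space = (\<lambda>n. quotient_space (op_space P n) (J n)),
     op_id = J 1 +>\<^bsub>op_space P 1\<^esub> op_id P,
     op_comp = (\<lambda>ns X Ys. J (sum_list ns) +>\<^bsub>op_space P (sum_list ns)\<^esub>
                             op_comp P ns (repr X) (map repr Ys)),
     op_act = (\<lambda>n \<sigma> X. J n +>\<^bsub>op_space P n\<^esub> op_act P n \<sigma> (repr X))\<rparr>"

text \<open>
  The free symmetric operad on a family \<open>E\<close> of sets of generators (\<open>E n\<close> being the generators of
  arity \<open>n\<close>, without symmetries) has as a basis of its arity \<open>n\<close> part the planar trees with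
  vertices decorated by generators and with leaves numbered bijectively by \<open>0, \<dots>, n - 1\<close>.
\<close>

datatype 'g tree = Leaf nat | Node 'g "'g tree list"

primrec leaves :: "'g tree \<Rightarrow> nat list" where
  "leaves (Leaf i) = [i]"
| "leaves (Node g ts) = concat (map leaves ts)"

primrec well_decorated :: "(nat \<Rightarrow> 'g set) \<Rightarrow> 'g tree \<Rightarrow> bool" where
  "well_decorated E (Leaf i) \<longleftrightarrow> True"
| "well_decorated E (Node g ts) \<longleftrightarrow> g \<in> E (length ts) \<and> list_all (well_decorated E) ts"

primrec subst_tree :: "(nat \<Rightarrow> 'g tree) \<Rightarrow> 'g tree \<Rightarrow> 'g tree" where
  "subst_tree f (Leaf i) = f i"
| "subst_tree f (Node g ts) = Node g (map (subst_tree f) ts)"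

definition relabel :: "(nat \<Rightarrow> nat) \<Rightarrow> 'g tree \<Rightarrow> 'g tree" where
  "relabel f = subst_tree (\<lambda>i. Leaf (f i))"

definition tree_monomials :: "(nat \<Rightarrow> 'g set) \<Rightarrow> nat \<Rightarrow> 'g tree set" where
  "tree_monomials E n =
     {t. well_decorated E t \<and> distinct (leaves t) \<and> set (leaves t) = {..<n}}"

text \<open>Grafting of \<open>ts ! i\<close>, of arity \<open>ns ! i\<close>, onto the leaf \<open>i\<close> of \<open>t\<close>, with the leaves of the
  trees \<open>ts ! i\<close> renumbered consecutively.\<close>

definition graft :: "nat list \<Rightarrow> 'g tree \<Rightarrow> 'g tree list \<Rightarrow> 'g tree" where
  "graft ns t ts = subst_tree (\<lambda>i. relabel (\<lambda>j. sum_list (take i ns) + j) (ts ! i)) t"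

text \<open>
  The action: a tree \<open>t\<close> is thought of as the operation
  \<open>(x\<^sub>0, \<dots>, x\<^sub>n\<^sub>-\<^sub>1) \<mapsto> t(x\<^sub>0, \<dots>, x\<^sub>n\<^sub>-\<^sub>1)\<close>, and \<open>t \<cdot> \<sigma>\<close> evaluates \<open>t\<close> at
  the tuple whose \<open>\<sigma> i\<close>-th entry is \<open>x\<^sub>i\<close>. This matches \<^const>\<open>tensor_perm\<close>: the output of a
  cooperation sitting at the leaf \<open>\<sigma> i\<close> becomes the \<open>i\<close>-th output.
\<close>

definition free_operad :: "(nat \<Rightarrow> 'g set) \<Rightarrow> ('k::field, 'g tree \<Rightarrow>\<^sub>0 'k) operad" where
  "free_operad E = \<lparr>
     op_space = (\<lambda>n. free_space (tree_monomials E n)),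
     op_id = Poly_Mapping.single (Leaf 0) 1,
     op_comp = (\<lambda>ns p qs. multilinear_ext (\<lambda>ts. graft ns (hd ts) (tl ts)) (p # qs)),
     op_act = (\<lambda>n \<sigma>. linear_ext (relabel (inv_into UNIV \<sigma>)))\<rparr>"

definition presented_operad ::
    "(nat \<Rightarrow> 'g set) \<Rightarrow> (nat \<Rightarrow> ('g tree \<Rightarrow>\<^sub>0 'k) set)
      \<Rightarrow> ('k::field, ('g tree \<Rightarrow>\<^sub>0 'k) set) operad" where
  "presented_operad E R = quotient_operad (free_operad E) (ideal_generated_by (free_operad E) R)"


subsection \<open>Coalgebras over an operad\<close>

definition Coend :: "('k::field, 'v) module \<Rightarrow> ('k, 'v \<Rightarrow> ('k, 'v) tensor) operad" where
  "Coend V = \<lparr>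
     op_space = (\<lambda>n. hom_space V (tensor_power V n)),
     op_id = (\<lambda>v\<in>carrier V. pure_tensor V [v]),
     op_comp = (\<lambda>ns f gs. \<lambda>v\<in>carrier V. tensor_of_maps V ns gs (f v)),
     op_act = (\<lambda>n \<sigma> f. \<lambda>v\<in>carrier V. tensor_perm V n \<sigma> (f v))\<rparr>"

type_synonym ('k, 'p, 'v) coaction = "nat \<Rightarrow> 'p \<Rightarrow> 'v \<Rightarrow> ('k, 'v) tensor"

definition coalgebra ::
    "('k::field, 'p) operad \<Rightarrow> ('k, 'v) module \<Rightarrow> ('k, 'p, 'v) coaction \<Rightarrow> bool" where
  "coalgebra P V \<phi> \<longleftrightarrow> vector_space_on V \<and> operad_morphism P (Coend V) \<phi>"

definition coalgebra_morphisms ::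
    "('k::field, 'p) operad \<Rightarrow> ('k, 'v) module \<Rightarrow> ('k, 'p, 'v) coaction
      \<Rightarrow> ('k, 'w) module \<Rightarrow> ('k, 'p, 'w) coaction \<Rightarrow> ('v \<Rightarrow> 'w) set" where
  "coalgebra_morphisms P V \<phi> W \<psi> = {f \<in> linear_maps V W.
     \<forall>n. \<forall>p\<in>carrier (op_space P n). \<forall>v\<in>carrier V.
       \<psi> n p (f v) = tensor_power_map W n f (\<phi> n p v)}"


section \<open>The comonad of the cofree coalgebra functor\<close>

text \<open>
  In this section all vector spaces have their carrier in one fixed but arbitrary type \<open>'u\<close>, which
  plays the role of the universe. A right adjoint of the forgetful functor is given by a universal
  arrow \<open>cofree_counit W\<close> from the forgetful functor to each vector space \<open>W\<close>.
\<close>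

record (overloaded) ('k, 'p, 'u) cofree_functor =
  cofree_space :: "('k, 'u) module \<Rightarrow> ('k, 'u) module"
  cofree_coaction :: "('k, 'u) module \<Rightarrow> ('k, 'p, 'u) coaction"
  cofree_counit :: "('k, 'u) module \<Rightarrow> 'u \<Rightarrow> 'u"

definition colifts ::
    "('k::field, 'p) operad \<Rightarrow> ('k, 'p, 'u) cofree_functor \<Rightarrow> ('k, 'u) module
      \<Rightarrow> ('k, 'u) module \<Rightarrow> ('k, 'p, 'u) coaction \<Rightarrow> ('u \<Rightarrow> 'u) \<Rightarrow> ('u \<Rightarrow> 'u) set" where
  "colifts P R W X \<xi> f =
     {g \<in> coalgebra_morphisms P X \<xi> (cofree_space R W) (cofree_coaction R W).
        \<forall>x\<in>carrier X. cofree_counit R W (g x) = f x}"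

definition right_adjoint_to_forgetful ::
    "('k::field, 'p) operad \<Rightarrow> ('k, 'p, 'u) cofree_functor \<Rightarrow> bool" where
  "right_adjoint_to_forgetful P R \<longleftrightarrow> (\<forall>W. vector_space_on W \<longrightarrow>
     coalgebra P (cofree_space R W) (cofree_coaction R W) \<and>
     cofree_counit R W \<in> linear_maps (cofree_space R W) W \<and>
     (\<forall>X \<xi> f. coalgebra P X \<xi> \<and> f \<in> linear_maps X W \<longrightarrow> (\<exists>!g. g \<in> colifts P R W X \<xi> f)))"

record ('k, 'u) comonad =
  com_obj :: "('k, 'u) module \<Rightarrow> ('k, 'u) module"
  com_map :: "('k, 'u) module \<Rightarrow> ('k, 'u) module \<Rightarrow> ('u \<Rightarrow> 'u) \<Rightarrow> 'u \<Rightarrow> 'u"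
  com_counit :: "('k, 'u) module \<Rightarrow> 'u \<Rightarrow> 'u"
  com_comult :: "('k, 'u) module \<Rightarrow> 'u \<Rightarrow> 'u"

text \<open>The comonad \<open>U R\<close> of the adjunction: its comultiplication is \<open>U \<eta> R\<close>, where the component of
  the unit \<open>\<eta>\<close> at a coalgebra is the colift of the identity.\<close>

definition associated_comonad ::
    "('k::field, 'p) operad \<Rightarrow> ('k, 'p, 'u) cofree_functor \<Rightarrow> ('k, 'u) comonad" where
  "associated_comonad P R = \<lparr>
     com_obj = cofree_space R,
     com_map = (\<lambda>W W' h. THE g. g \<in> colifts P R W' (cofree_space R W) (cofree_coaction R W)
                  (compose (carrier (cofree_space R W)) h (cofree_counit R W))),
     com_counit = cofree_counit R,
     com_comult = (\<lambda>W. THE g. g \<in> colifts P R (cofree_space R W)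
                  (cofree_space R W) (cofree_coaction R W) (\<lambda>x\<in>carrier (cofree_space R W). x))\<rparr>"

definition is_zero_comonad :: "('k::field, 'u) comonad \<Rightarrow> bool" where
  "is_zero_comonad C \<longleftrightarrow> (\<forall>W. vector_space_on W \<longrightarrow>
     is_zero_space (com_obj C W) \<and>
     (\<forall>W' h. vector_space_on W' \<and> h \<in> linear_maps W W' \<longrightarrow>
        com_map C W W' h = zero_map (com_obj C W) (com_obj C W')) \<and>
     com_counit C W = zero_map (com_obj C W) W \<and>
     com_comult C W = zero_map (com_obj C W) (com_obj C (com_obj C W)))"


section \<open>The operad Ins\<close>

text \<open>\<open>Ups 0\<close> is the unit of the associative algebra.\<close>

datatype 'l ins_symbol = Mu | Ups nat | Inv 'l

type_synonym 'k ins_gen = "(nat \<Rightarrow>\<^sub>0 'k) ins_symbol"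

definition ins_generators :: "nat \<Rightarrow> 'k::field ins_gen set" where
  "ins_generators n =
     (if n = 0 then {Ups i | i. True}
      else if n = 1 then {Inv l | l. l \<noteq> 0}
      else if n = 2 then {Mu}
      else {})"

definition ins_inverse_relation :: "(nat \<Rightarrow>\<^sub>0 'k::field) \<Rightarrow> ('k ins_gen tree \<Rightarrow>\<^sub>0 'k)" where
  "ins_inverse_relation l =
     (\<Sum>i\<in>Poly_Mapping.keys l.
        Poly_Mapping.single (Node Mu [Node (Ups i) [], Node (Inv l) [Leaf 0]])
          (Poly_Mapping.lookup l i))
     - Poly_Mapping.single (Leaf 0) 1"

definition ins_relations :: "nat \<Rightarrow> ('k::field ins_gen tree \<Rightarrow>\<^sub>0 'k) set" where
  "ins_relations n =
     (if n = 1 then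
        {Poly_Mapping.single (Node Mu [Node (Ups 0) [], Leaf 0]) 1 - Poly_Mapping.single (Leaf 0) 1,
         Poly_Mapping.single (Node Mu [Leaf 0, Node (Ups 0) []]) 1 - Poly_Mapping.single (Leaf 0) 1}
        \<union> {ins_inverse_relation l | l. l \<noteq> 0}
      else if n = 3 then
        {Poly_Mapping.single (Node Mu [Node Mu [Leaf 0, Leaf 1], Leaf 2]) 1
           - Poly_Mapping.single (Node Mu [Leaf 0, Node Mu [Leaf 1, Leaf 2]]) 1}
      else {})"

definition Ins :: "('k::field, ('k ins_gen tree \<Rightarrow>\<^sub>0 'k) set) operad" where
  "Ins = presented_operad ins_generators ins_relations"

end

theory Submission
  imports Defs "HOL-Computational_Algebra.Polynomial_Factorial"
begin

text \<open>
  \<open>Ins\<close> acts on the one-dimensional vector space over \<open>K(x)\<close>, with \<open>\<upsilon>\<^sub>n\<close> acting as \<open>x\<^sup>n\<close> and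
  \<open>I\<^sub>\<lambda>\<close> as multiplication by the inverse of the non-zero polynomial \<open>\<Sum>\<lambda>\<^sub>n x\<^sup>n\<close>, so it is not zero. In a
  coalgebra, \<open>\<delta>(v)\<close> is a finite sum of tensors \<open>a \<otimes> b\<close>. There are infinitely many forms \<open>\<epsilon>\<^sub>n\<close>, so some
  non-zero combination \<open>\<Sum>\<lambda>\<^sub>n \<epsilon>\<^sub>n\<close> vanishes at all these \<open>a\<close>, and the relation for this \<open>\<lambda>\<close> reads
  \<open>v = 0\<close>. The cofree coalgebra functor is therefore zero.
\<close>

section \<open>Linear combinations\<close>

text \<open>Evaluating x at a scalar c would not do: x - c would then act as 0, while every non-zero
  combination has to be invertible; hence the transcendental x and the field K(x). Commutativity
  matters as well: a tree acts through the product of its vertex weights, which sees neither the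
  planar order nor the numbering of the leaves. The kernel of the action is therefore an operadic
  ideal of the free operad by a direct check, and no endomorphism operad has to be built. The two
  halves do not conflict: an algebra may contain infinitely many independent constants, while one
  vector of a coalgebra meets only the finitely many left factors of its coproduct. The order of
  choices is essential: the representative of delta(v) and all the forms are fixed before lambda,
  which may depend on v. Maps out of tensor powers are given by formulas on arbitrary coset
  representatives. The coalgebra argument therefore keeps one representative of delta(v) for all n
  and carries out the cancellation in the free space, before passing to the tensor power.\<close>

abbreviation scale :: "'k \<Rightarrow> ('a \<Rightarrow>\<^sub>0 'k::field) \<Rightarrow> ('a \<Rightarrow>\<^sub>0 'k)" where
  "scale c \<equiv> Poly_Mapping.map ((*) c)"

abbreviation basis :: "'a \<Rightarrow> ('a \<Rightarrow>\<^sub>0 'k::field)" where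
  "basis x \<equiv> Poly_Mapping.single x 1"

lemma lookup_scale [simp]: "Poly_Mapping.lookup (scale c p) x = c * Poly_Mapping.lookup p x"
  by (simp add: Poly_Mapping.map.rep_eq when_def)

lemma keys_scale: "Poly_Mapping.keys (scale c p) \<subseteq> Poly_Mapping.keys p"
  by (auto simp: in_keys_iff)

lemma scale_simps [simp]:
  "scale c 0 = 0" "scale 0 p = 0" "scale 1 p = p"
  "scale c (scale d p) = scale (c * d) p"
  "scale c (Poly_Mapping.single x d) = Poly_Mapping.single x (c * d)"
  by (auto intro!: poly_mapping_eqI simp: lookup_single when_def)

lemma scale_add: "scale c (p + q) = scale c p + scale c q"
  by (rule poly_mapping_eqI) (simp add: lookup_add algebra_simps)

lemma scale_diff: "scale c (p - q) = scale c p - scale c q"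
  by (rule poly_mapping_eqI) (simp add: lookup_minus algebra_simps)

lemma add_scale: "scale (c + d) p = scale c p + scale d p"
  by (rule poly_mapping_eqI) (simp add: lookup_add algebra_simps)

lemma diff_scale: "scale (c - d) p = scale c p - scale d p"
  by (rule poly_mapping_eqI) (simp add: lookup_minus algebra_simps)

lemma scale_sum: "scale c (\<Sum>i\<in>A. f i) = (\<Sum>i\<in>A. scale c (f i))"
  by (induction A rule: infinite_finite_induct) (auto simp: scale_add)

lemma scale_uminus: "scale (-1) p = - p"
  by (auto intro!: poly_mapping_eqI)

text \<open>Unlike in \<open>linear_ext\<close>, the values are vectors and not basis elements. This
  allows nesting, so that multilinear extensions become iterated linear ones.\<close>

definition lin_extend :: "('a \<Rightarrow> 'b \<Rightarrow>\<^sub>0 'k::field) \<Rightarrow> ('a \<Rightarrow>\<^sub>0 'k) \<Rightarrow> ('b \<Rightarrow>\<^sub>0 'k)" where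
  "lin_extend G p = (\<Sum>t\<in>Poly_Mapping.keys p. scale (Poly_Mapping.lookup p t) (G t))"

lemma lin_extend_superset:
  assumes "finite A" "Poly_Mapping.keys p \<subseteq> A"
  shows "lin_extend G p = (\<Sum>t\<in>A. scale (Poly_Mapping.lookup p t) (G t))"
  unfolding lin_extend_def
  by (rule sum.mono_neutral_left) (use assms in \<open>auto simp: in_keys_iff\<close>)

lemma lin_extend_0 [simp]: "lin_extend G 0 = 0"
  by (simp add: lin_extend_def)

lemma lin_extend_diff: "lin_extend G (p - q) = lin_extend G p - lin_extend G q"
proof -
  let ?A = "Poly_Mapping.keys p \<union> Poly_Mapping.keys q"
  show ?thesis
    by (subst (1 2 3) lin_extend_superset[where A = ?A])
       (auto simp: keys_diff lookup_minus diff_scale sum_subtractf)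
qed

lemma lin_extend_diff_fun: "lin_extend (\<lambda>t. F t - G t) p = lin_extend F p - lin_extend G p"
  by (simp add: lin_extend_def scale_diff sum_subtractf)

lemma lin_extend_single [simp]: "lin_extend G (Poly_Mapping.single x c) = scale c (G x)"
  by (simp add: lin_extend_def)

lemma lin_extend_basis: "lin_extend basis p = p"
  by (rule poly_mapping_eqI)
     (auto simp: lin_extend_def lookup_sum lookup_single when_def in_keys_iff)

lemma keys_lin_extend:
  "Poly_Mapping.keys (lin_extend G p) \<subseteq> (\<Union>t\<in>Poly_Mapping.keys p. Poly_Mapping.keys (G t))"
  unfolding lin_extend_def by (rule order_trans[OF keys_sum]) (intro UN_mono order_refl keys_scale)

lemma linear_ext_eq_lin_extend: "linear_ext F = lin_extend (\<lambda>t. basis (F t))"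
  by (auto simp: linear_ext_def lin_extend_def fun_eq_iff)

lemma multilinear_ext_Nil [simp]: "multilinear_ext F [] = basis (F [])"
  by (simp add: multilinear_ext_def)

text \<open>A choice of one key from each argument is a key of the first together with a choice from
  the rest. Later inductions on the argument list use this recursion in place of the sum over
  \<open>listset\<close>.\<close>

lemma multilinear_ext_Cons [simp]:
  "multilinear_ext F (p # ps) = lin_extend (\<lambda>t. multilinear_ext (\<lambda>ts. F (t # ts)) ps) p"
proof -
  let ?L = "listset (map Poly_Mapping.keys ps)"
  have "multilinear_ext F (p # ps) =
      (\<Sum>ts\<in>(\<lambda>(t, ts). t # ts) ` (Poly_Mapping.keys p \<times> ?L).
         Poly_Mapping.single (F ts) (prod_list (map2 Poly_Mapping.lookup (p # ps) ts)))"
    unfolding multilinear_ext_def by (rule sum.cong) (auto simp: set_Cons_def)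
  also have "\<dots> = (\<Sum>(t, ts)\<in>Poly_Mapping.keys p \<times> ?L.
         Poly_Mapping.single (F (t # ts))
           (Poly_Mapping.lookup p t * prod_list (map2 Poly_Mapping.lookup ps ts)))"
    by (subst sum.reindex) (auto simp: inj_on_def case_prod_unfold)
  also have "\<dots> = lin_extend (\<lambda>t. multilinear_ext (\<lambda>ts. F (t # ts)) ps) p"
    by (simp add: lin_extend_def multilinear_ext_def sum.cartesian_product[symmetric] scale_sum)
  finally show ?thesis .
qed

lemma multilinear_ext_diff:
  "multilinear_ext F (us @ (x - y) # ws)
     = multilinear_ext F (us @ x # ws) - multilinear_ext F (us @ y # ws)"
  by (induction us arbitrary: F) (simp_all add: lin_extend_diff lin_extend_diff_fun)

lemma multilinear_ext_zero: "0 \<in> set ps \<Longrightarrow> multilinear_ext F ps = 0"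
  by (induction ps arbitrary: F) (auto simp: lin_extend_def)

lemma keys_multilinear_ext:
  "Poly_Mapping.keys (multilinear_ext F ps) \<subseteq> F ` listset (map Poly_Mapping.keys ps)"
proof (induction ps arbitrary: F)
  case (Cons p ps)
  show ?case
  proof
    fix s assume "s \<in> Poly_Mapping.keys (multilinear_ext F (p # ps))"
    then obtain t where t: "t \<in> Poly_Mapping.keys p"
      "s \<in> Poly_Mapping.keys (multilinear_ext (\<lambda>ts. F (t # ts)) ps)"
      using keys_lin_extend[of "\<lambda>t. multilinear_ext (\<lambda>ts. F (t # ts)) ps" p]
      unfolding multilinear_ext_Cons by blast
    then obtain ts where "ts \<in> listset (map Poly_Mapping.keys ps)" "s = F (t # ts)"
      using Cons[of "\<lambda>ts. F (t # ts)"] by blast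
    with t(1) show "s \<in> F ` listset (map Poly_Mapping.keys (p # ps))"
      by (intro image_eqI[of _ _ "t # ts"]) (auto simp: set_Cons_def)
  qed
qed simp

lemma in_listset_iff: "ts \<in> listset As \<longleftrightarrow> list_all2 (\<in>) ts As"
proof (induction As arbitrary: ts)
  case (Cons A As)
  then show ?case by (cases ts) (auto simp: set_Cons_def)
qed simp

section \<open>Free spaces, spans and quotients\<close>

lemma free_space_simps [simp]:
  "carrier (free_space X) = {p. Poly_Mapping.keys p \<subseteq> X}"
  "zero (free_space X) = 0" "add (free_space X) = (+)" "module.smult (free_space X) = scale"
  by (auto simp: free_space_def)

lemma vector_space_free_space: "vector_space_on (free_space X :: ('k::field, 'x \<Rightarrow>\<^sub>0 'k) module)"
proof (intro Module.moduleI)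
  show "cring (cring_class_ops :: 'k ring)" by (rule cring_class)
  show "abelian_group (free_space X :: ('k, 'x \<Rightarrow>\<^sub>0 'k) module)"
  proof (rule abelian_groupI)
    fix x y assume "x \<in> carrier (free_space X :: ('k, 'x \<Rightarrow>\<^sub>0 'k) module)"
      "y \<in> carrier (free_space X :: ('k, 'x \<Rightarrow>\<^sub>0 'k) module)"
    then show "x \<oplus>\<^bsub>free_space X\<^esub> y \<in> carrier (free_space X)"
      using keys_add[of x y] by auto
  next
    fix x assume "x \<in> carrier (free_space X :: ('k, 'x \<Rightarrow>\<^sub>0 'k) module)"
    then show "\<exists>y\<in>carrier (free_space X). y \<oplus>\<^bsub>free_space X\<^esub> x = \<zero>\<^bsub>free_space X\<^esub>"
      by (intro bexI[of _ "- x"]) auto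
  qed (auto simp: add.assoc add.commute)
next
  fix a :: 'k and x assume "x \<in> carrier (free_space X :: ('k, 'x \<Rightarrow>\<^sub>0 'k) module)"
  then show "a \<odot>\<^bsub>free_space X\<^esub> x \<in> carrier (free_space X)"
    using keys_scale[of a x] by auto
qed (simp_all add: class_simps scale_add add_scale)

lemma minus_free_space:
  fixes p :: "'x \<Rightarrow>\<^sub>0 'k::field"
  assumes "p \<in> carrier (free_space X)"
  shows "\<ominus>\<^bsub>free_space X\<^esub> p = - p"
proof -
  interpret Module.module "cring_class_ops :: 'k ring" "free_space X :: ('k, 'x \<Rightarrow>\<^sub>0 'k) module"
    by (rule vector_space_free_space)
  show ?thesis using assms minus_equality[of "- p" p] by auto
qed

text \<open>Negation is scaling by -1, and zero is scaling any element of a submodule by 0, so the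
  group conditions reduce to sums and scalings.\<close>

lemma subspace_free_space_iff:
  fixes S :: "('x \<Rightarrow>\<^sub>0 'k::field) set"
  shows "subspace_of S (free_space X) \<longleftrightarrow>
    S \<subseteq> {p. Poly_Mapping.keys p \<subseteq> X} \<and> 0 \<in> S \<and> (\<forall>p\<in>S. \<forall>q\<in>S. p + q \<in> S) \<and> (\<forall>c. \<forall>p\<in>S. scale c p \<in> S)"
  (is "?L \<longleftrightarrow> ?R")
proof
  interpret Module.module "cring_class_ops :: 'k ring" "free_space X :: ('k, 'x \<Rightarrow>\<^sub>0 'k) module"
    by (rule vector_space_free_space)
  {
    assume ?L
    note * = submoduleE[OF this]
    obtain p where p: "p \<in> S" using *(2) by auto
    have "scale 0 p \<in> S" using *(4)[of 0 p] p by (simp add: carrier_class)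
    then have "0 \<in> S" by simp
    then show ?R using * by (auto simp: carrier_class)
  next
    assume R: ?R
    show ?L
    proof (rule submoduleI)
      fix a assume "a \<in> S"
      moreover have "scale (-1) a \<in> S" using R \<open>a \<in> S\<close> by blast
      ultimately show "\<ominus>\<^bsub>free_space X\<^esub> a \<in> S"
        using R by (subst minus_free_space) (auto simp: scale_uminus)
    qed (use R in auto)
  }
qed

lemma subspaceD:
  assumes "subspace_of S (free_space X :: ('k::field, 'x \<Rightarrow>\<^sub>0 'k) module)"
  shows "p \<in> S \<Longrightarrow> Poly_Mapping.keys p \<subseteq> X" "0 \<in> S"
    "p \<in> S \<Longrightarrow> q \<in> S \<Longrightarrow> p + q \<in> S" "p \<in> S \<Longrightarrow> scale c p \<in> S"
    "p \<in> S \<Longrightarrow> - p \<in> S" "p \<in> S \<Longrightarrow> q \<in> S \<Longrightarrow> p - q \<in> S"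
proof -
  note * = assms[unfolded subspace_free_space_iff]
  show "p \<in> S \<Longrightarrow> Poly_Mapping.keys p \<subseteq> X" "0 \<in> S"
    "p \<in> S \<Longrightarrow> q \<in> S \<Longrightarrow> p + q \<in> S" "p \<in> S \<Longrightarrow> scale c p \<in> S"
    using * by auto
  show neg: "p \<in> S \<Longrightarrow> - p \<in> S" for p
    using *[THEN conjunct2, THEN conjunct2, THEN conjunct2, rule_format, of p "-1"] by (simp add: scale_uminus)
  show "p \<in> S \<Longrightarrow> q \<in> S \<Longrightarrow> p - q \<in> S"
    using *[THEN conjunct2, THEN conjunct2, THEN conjunct1, rule_format, of p "- q"] neg[of q] by simp
qed

lemma subspace_lin_extend:
  assumes "subspace_of S (free_space X)" "\<And>t. t \<in> Poly_Mapping.keys p \<Longrightarrow> G t \<in> S"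
  shows "lin_extend G p \<in> S"
proof -
  have "(\<Sum>t\<in>A. scale (c t) (G t)) \<in> S" if "finite A" "\<And>t. t \<in> A \<Longrightarrow> G t \<in> S" for A c
    using that by (induction A) (auto intro!: subspaceD[OF assms(1)])
  then show ?thesis using assms(2) by (simp add: lin_extend_def)
qed

lemma subspace_Inter:
  assumes "\<F> \<noteq> {}" "\<And>S. S \<in> \<F> \<Longrightarrow> subspace_of S (free_space X :: ('k::field, 'x \<Rightarrow>\<^sub>0 'k) module)"
  shows "subspace_of (\<Inter>\<F>) (free_space X)"
  using assms unfolding subspace_free_space_iff by blast

lemma subspace_carrier: "subspace_of {p. Poly_Mapping.keys p \<subseteq> X} (free_space X :: ('k::field, 'x \<Rightarrow>\<^sub>0 'k) module)"
  using Module.module.carrier_is_submodule[OF vector_space_free_space, of X] by simp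

lemma subspace_span:
  assumes "A \<subseteq> {p. Poly_Mapping.keys p \<subseteq> X}"
  shows "subspace_of (subspace_span (free_space X) A) (free_space X :: ('k::field, 'x \<Rightarrow>\<^sub>0 'k) module)"
  unfolding subspace_span_def by (rule subspace_Inter) (use assms subspace_carrier in auto)

lemma span_superset: "A \<subseteq> subspace_span V A"
  by (auto simp: subspace_span_def)

lemma span_minimal: "subspace_of S V \<Longrightarrow> A \<subseteq> S \<Longrightarrow> subspace_span V A \<subseteq> S"
  by (auto simp: subspace_span_def)

section \<open>Cosets, their chosen representatives, and the operations of the quotient\<close>

lemma coset_eq: "S +>\<^bsub>free_space X\<^esub> x = (\<lambda>s. s + x) ` S"
  by (auto simp: a_r_coset_def')

lemma coset_zero [simp]: "S +>\<^bsub>free_space X\<^esub> 0 = S"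
  by (simp add: coset_eq)

lemma repr_in: "X \<noteq> {} \<Longrightarrow> repr X \<in> X"
  by (auto simp: repr_def intro: someI)

context
  fixes S :: "('x \<Rightarrow>\<^sub>0 'k::field) set" and X
  assumes S: "subspace_of S (free_space X)"
begin

lemma coset_eq_iff: "S +>\<^bsub>free_space X\<^esub> x = S +>\<^bsub>free_space X\<^esub> y \<longleftrightarrow> x - y \<in> S"
proof
  assume "S +>\<^bsub>free_space X\<^esub> x = S +>\<^bsub>free_space X\<^esub> y"
  moreover have "0 + x \<in> S +>\<^bsub>free_space X\<^esub> x" unfolding coset_eq using subspaceD(2)[OF S] by blast
  ultimately obtain s where "s \<in> S" "0 + x = s + y" by (auto simp: coset_eq)
  then show "x - y \<in> S" by simp
next
  assume xy: "x - y \<in> S"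
  have "s + x \<in> (\<lambda>s. s + y) ` S" if "s \<in> S" for s
    using subspaceD(3)[OF S that xy] by (intro image_eqI[of _ _ "s + (x - y)"]) auto
  moreover have "s + y \<in> (\<lambda>s. s + x) ` S" if "s \<in> S" for s
    using subspaceD(6)[OF S that xy] by (intro image_eqI[of _ _ "s - (x - y)"]) auto
  ultimately show "S +>\<^bsub>free_space X\<^esub> x = S +>\<^bsub>free_space X\<^esub> y" unfolding coset_eq by blast
qed

lemma coset_eq_self_iff: "S +>\<^bsub>free_space X\<^esub> x = S \<longleftrightarrow> x \<in> S"
  using coset_eq_iff[of x 0] by simp

text \<open>The arbitrary choice made by \<open>repr\<close> moves a vector only by an element of
  \<open>S\<close>; the well-definedness of composition in \<open>Ins\<close> rests on this.\<close>

lemma repr_coset: "repr (S +>\<^bsub>free_space X\<^esub> x) - x \<in> S"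
proof -
  have "repr (S +>\<^bsub>free_space X\<^esub> x) \<in> S +>\<^bsub>free_space X\<^esub> x"
    by (rule repr_in) (use subspaceD(2)[OF S] in \<open>auto simp: coset_eq\<close>)
  then show ?thesis by (auto simp: coset_eq)
qed

lemma carrier_quotient: "carrier (quotient_space (free_space X) S) = (\<lambda>x. S +>\<^bsub>free_space X\<^esub> x) ` {p. Poly_Mapping.keys p \<subseteq> X}"
  by (auto simp: quotient_space_def A_RCOSETS_def')

lemma keys_repr:
  assumes "C \<in> carrier (quotient_space (free_space X) S)"
  shows "Poly_Mapping.keys (repr C) \<subseteq> X"
proof -
  obtain x where x: "C = S +>\<^bsub>free_space X\<^esub> x" "Poly_Mapping.keys x \<subseteq> X"
    using assms unfolding carrier_quotient by blast
  have "Poly_Mapping.keys (repr C - x) \<subseteq> X" using subspaceD(1)[OF S repr_coset[of x]] by (simp add: x)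
  then have "Poly_Mapping.keys ((repr C - x) + x) \<subseteq> X" using x(2) keys_add[of "repr C - x" x] by blast
  then show ?thesis by simp
qed

lemma zero_quotient [simp]: "\<zero>\<^bsub>quotient_space (free_space X) S\<^esub> = S"
  by (simp add: quotient_space_def)

lemma add_quotient:
  "(S +>\<^bsub>free_space X\<^esub> x) \<oplus>\<^bsub>quotient_space (free_space X) S\<^esub> (S +>\<^bsub>free_space X\<^esub> y)
     = S +>\<^bsub>free_space X\<^esub> (x + y)"
proof -
  have "s1 + x + (s2 + y) \<in> (\<lambda>s. s + (x + y)) ` S" if "s1 \<in> S" "s2 \<in> S" for s1 s2
    using subspaceD(3)[OF S that] by (intro image_eqI[of _ _ "s1 + s2"]) (auto simp: add_ac)
  moreover have "\<exists>s1\<in>S. \<exists>s2\<in>S. s + (x + y) = s1 + x + (s2 + y)" if "s \<in> S" for s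
    using subspaceD(2)[OF S] that by (intro bexI[of _ s] bexI[of _ 0]) (auto simp: add_ac)
  ultimately have "{u + v | u v. u \<in> (\<lambda>s. s + x) ` S \<and> v \<in> (\<lambda>s. s + y) ` S} = (\<lambda>s. s + (x + y)) ` S"
    by blast
  moreover have "(A <+>\<^bsub>free_space X\<^esub> B) = {u + v | u v. u \<in> A \<and> v \<in> B}" for A B :: "('x \<Rightarrow>\<^sub>0 'k) set"
    by (auto simp: set_add_def')
  ultimately show ?thesis by (simp add: quotient_space_def coset_eq)
qed

text \<open>For c = 0 the scaled elements of a coset form only the set {0}; the summand
  \<open>S\<close> in the definition of the scalar action turns this back into a coset.\<close>

lemma smult_quotient:
  "c \<odot>\<^bsub>quotient_space (free_space X) S\<^esub> (S +>\<^bsub>free_space X\<^esub> x) = S +>\<^bsub>free_space X\<^esub> (scale c x)"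
proof -
  have "s1 + scale c (s2 + x) \<in> (\<lambda>s. s + scale c x) ` S" if "s1 \<in> S" "s2 \<in> S" for s1 s2
    using subspaceD(3)[OF S that(1) subspaceD(4)[OF S that(2), of c]]
    by (intro image_eqI[of _ _ "s1 + scale c s2"]) (auto simp: add_ac scale_add)
  moreover have "\<exists>s1\<in>S. \<exists>s2\<in>S. s + scale c x = s1 + scale c (s2 + x)" if "s \<in> S" for s
    using subspaceD(2)[OF S] that by (intro bexI[of _ s] bexI[of _ 0]) auto
  ultimately have "{u + v | u v. u \<in> S \<and> v \<in> scale c ` (\<lambda>s. s + x) ` S} = (\<lambda>s. s + scale c x) ` S"
    by blast
  moreover have "(A <+>\<^bsub>free_space X\<^esub> B) = {u + v | u v. u \<in> A \<and> v \<in> B}" for A B :: "('x \<Rightarrow>\<^sub>0 'k) set"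
    by (auto simp: set_add_def')
  ultimately show ?thesis by (simp add: quotient_space_def coset_eq)
qed

lemma zero_in_quotient: "S \<in> carrier (quotient_space (free_space X) S)"
  unfolding carrier_quotient by (rule image_eqI[of _ _ 0]) auto

lemma add_zero_quotient [simp]: "S \<oplus>\<^bsub>quotient_space (free_space X) S\<^esub> S = S"
  using add_quotient[of 0 0] by simp

lemma smult_zero_quotient [simp]: "c \<odot>\<^bsub>quotient_space (free_space X) S\<^esub> S = S"
  using smult_quotient[of c 0] by simp

lemma zero_smult_quotient:
  "C \<in> carrier (quotient_space (free_space X) S) \<Longrightarrow> 0 \<odot>\<^bsub>quotient_space (free_space X) S\<^esub> C = S"
  using smult_quotient[of 0] by (auto simp: carrier_quotient)

lemma coset_in_quotient:
  "Poly_Mapping.keys x \<subseteq> X \<Longrightarrow> S +>\<^bsub>free_space X\<^esub> x \<in> carrier (quotient_space (free_space X) S)"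
  by (auto simp: carrier_quotient)

lemma add_closed_quotient:
  assumes "C \<in> carrier (quotient_space (free_space X) S)"
    and "D \<in> carrier (quotient_space (free_space X) S)"
  shows "C \<oplus>\<^bsub>quotient_space (free_space X) S\<^esub> D \<in> carrier (quotient_space (free_space X) S)"
proof -
  obtain x y where *: "C = S +>\<^bsub>free_space X\<^esub> x" "Poly_Mapping.keys x \<subseteq> X"
    "D = S +>\<^bsub>free_space X\<^esub> y" "Poly_Mapping.keys y \<subseteq> X"
    using assms unfolding carrier_quotient by blast
  then have "Poly_Mapping.keys (x + y) \<subseteq> X" using keys_add[of x y] by blast
  then show ?thesis unfolding * add_quotient by (rule coset_in_quotient)
qed

lemma smult_closed_quotient:
  assumes "C \<in> carrier (quotient_space (free_space X) S)"
  shows "c \<odot>\<^bsub>quotient_space (free_space X) S\<^esub> C \<in> carrier (quotient_space (free_space X) S)"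
proof -
  obtain x where *: "C = S +>\<^bsub>free_space X\<^esub> x" "Poly_Mapping.keys x \<subseteq> X"
    using assms unfolding carrier_quotient by blast
  then have "Poly_Mapping.keys (scale c x) \<subseteq> X" using keys_scale[of c x] by blast
  then show ?thesis unfolding * smult_quotient by (rule coset_in_quotient)
qed

end

section \<open>Trees and operadic ideals\<close>

text \<open>Multisets of leaves are additive under concatenation and ignore the planar order, which
  makes this form suitable for grafting.\<close>

lemma tree_monomials_iff:
  "t \<in> tree_monomials E n \<longleftrightarrow> well_decorated E t \<and> mset (leaves t) = mset [0..<n]"
proof -
  have "distinct (leaves t) \<and> set (leaves t) = {..<n} \<longleftrightarrow> mset (leaves t) = mset [0..<n]"
    using set_eq_iff_mset_eq_distinct[of "leaves t" "[0..<n]"] mset_eq_setD[of "leaves t" "[0..<n]"]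
      mset_eq_imp_distinct_iff[of "leaves t" "[0..<n]"]
    by (auto simp: atLeast_upt)
  then show ?thesis by (auto simp: tree_monomials_def)
qed

lemma leaves_subst_tree: "leaves (subst_tree f t) = concat (map (\<lambda>i. leaves (f i)) (leaves t))"
proof (induction t)
  case (Node g ts)
  then show ?case by (induction ts) auto
qed simp

lemma leaves_relabel [simp]: "leaves (relabel h t) = map h (leaves t)"
  by (simp add: relabel_def leaves_subst_tree concat_map_singleton[of h])

lemma well_decorated_subst_tree:
  "well_decorated E t \<Longrightarrow> (\<And>i. i \<in> set (leaves t) \<Longrightarrow> well_decorated E (f i))
    \<Longrightarrow> well_decorated E (subst_tree f t)"
proof (induction t)
  case (Node g ts)
  then show ?case by (auto simp: list_all_iff)
qed simp

lemma well_decorated_relabel: "well_decorated E t \<Longrightarrow> well_decorated E (relabel h t)"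
  by (simp add: relabel_def well_decorated_subst_tree)

lemma mset_concat_map_cong:
  assumes "mset xs = mset ys" "\<And>x. x \<in> set ys \<Longrightarrow> mset (f x) = mset (g x)"
  shows "mset (concat (map f xs)) = mset (concat (map g ys))"
proof -
  have "mset (concat (map f xs)) = sum_mset (image_mset (\<lambda>x. mset (f x)) (mset xs))"
    by (simp add: mset_concat sum_mset_sum_list[symmetric] comp_def)
  also have "\<dots> = sum_mset (image_mset (\<lambda>x. mset (g x)) (mset ys))"
    unfolding assms(1) by (intro arg_cong[of _ _ sum_mset] image_mset_cong) (use assms(2) in auto)
  also have "\<dots> = mset (concat (map g ys))"
    by (simp add: mset_concat sum_mset_sum_list[symmetric] comp_def)
  finally show ?thesis .
qed

text \<open>These are the blocks of leaf numbers produced by \<open>graft\<close>; each starts where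
  the previous one ends. Appending an arity at the end leaves the earlier offsets unchanged, hence
  the induction from the right.\<close>

lemma concat_blocks:
  "concat (map (\<lambda>i. map ((+) (sum_list (take i ns))) [0..<ns ! i]) [0..<length ns]) = [0..<sum_list ns]"
proof (induction ns rule: rev_induct)
  case (snoc n ns)
  have *: "map (\<lambda>i. map ((+) (sum_list (take i (ns @ [n])))) [0..<(ns @ [n]) ! i]) [0..<length ns]
      = map (\<lambda>i. map ((+) (sum_list (take i ns))) [0..<ns ! i]) [0..<length ns]"
    by (auto simp: nth_append)
  have "concat (map (\<lambda>i. map ((+) (sum_list (take i (ns @ [n])))) [0..<(ns @ [n]) ! i]) [0..<length (ns @ [n])])
      = [0..<sum_list ns] @ map ((+) (sum_list ns)) [0..<n]"
    unfolding length_append_singleton upt_Suc_append[OF le0] map_append concat_append * snoc by simp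
  also have "\<dots> = [0..<sum_list (ns @ [n])]"
    using map_add_upt[of "sum_list ns" n] upt_add_eq_append[of 0 "sum_list ns" n]
      map_cong[OF refl, of "[0..<n]" "(+) (sum_list ns)" "\<lambda>i. i + sum_list ns"]
    by (simp add: add.commute)
  finally show ?case .
qed simp

text \<open>As a multiset, the leaves of \<open>t\<close> are 0, ..., \<open>length ns\<close> - 1,
  so the leaves of the graft can be listed in that order and counted by
  \<open>concat_blocks\<close>.\<close>

lemma graft_in_tree_monomials:
  assumes t: "t \<in> tree_monomials E (length ns)"
    and ts: "list_all2 (\<lambda>n s. s \<in> tree_monomials E n) ns ts"
  shows "graft ns t ts \<in> tree_monomials E (sum_list ns)"
proof -
  have ts_i: "ts ! i \<in> tree_monomials E (ns ! i)" if "i < length ns" for i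
    using ts that by (auto simp: list_all2_conv_all_nth)
  have t': "mset (leaves t) = mset [0..<length ns]" "well_decorated E t"
    using t by (auto simp: tree_monomials_iff)
  have "mset (leaves (graft ns t ts))
      = mset (concat (map (\<lambda>i. map ((+) (sum_list (take i ns))) [0..<ns ! i]) [0..<length ns]))"
    unfolding graft_def leaves_subst_tree
    by (rule mset_concat_map_cong[OF t'(1)]) (use ts_i in \<open>auto simp: tree_monomials_iff\<close>)
  moreover have "well_decorated E (graft ns t ts)"
    unfolding graft_def using mset_eq_setD[OF t'(1)] ts_i
    by (intro well_decorated_subst_tree[OF t'(2)] well_decorated_relabel)
       (auto simp: tree_monomials_iff)
  ultimately show ?thesis by (simp add: tree_monomials_iff concat_blocks)
qed

lemma relabel_in_tree_monomials:
  assumes "t \<in> tree_monomials E n" "\<sigma> permutes {..<n}"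
  shows "relabel \<sigma> t \<in> tree_monomials E n"
  using assms permutes_image[OF assms(2)]
  by (auto simp: tree_monomials_def well_decorated_relabel distinct_map inj_on_subset[OF permutes_inj])

section \<open>The free operad: closure of its operations, and generated ideals\<close>

lemma op_space_free [simp]: "op_space (free_operad E) n = free_space (tree_monomials E n)"
  and op_id_free [simp]: "op_id (free_operad E) = basis (Leaf 0)"
  and op_comp_free [simp]:
    "op_comp (free_operad E) ns p qs = multilinear_ext (\<lambda>ts. graft ns (hd ts) (tl ts)) (p # qs)"
  and op_act_free [simp]: "op_act (free_operad E) n \<sigma> p = lin_extend (\<lambda>t. basis (relabel (inv_into UNIV \<sigma>) t)) p"
  by (simp_all add: free_operad_def linear_ext_eq_lin_extend)

text \<open>Reduces statements about a composite of linear combinations to composable tuples of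
  single trees, one for each term of the multilinear expansion.\<close>

lemma free_composable_listset:
  assumes "composable (free_operad E) ns p qs"
    and "ts \<in> listset (map Poly_Mapping.keys (p # qs))"
  obtains s ss where "ts = s # ss" "s \<in> tree_monomials E (length ns)"
    "list_all2 (\<lambda>n s. s \<in> tree_monomials E n) ns ss"
proof -
  obtain s ss where *: "ts = s # ss" "s \<in> Poly_Mapping.keys p"
      "list_all2 (\<in>) ss (map Poly_Mapping.keys qs)"
    using assms(2) by (auto simp: set_Cons_def in_listset_iff)
  have **: "Poly_Mapping.keys p \<subseteq> tree_monomials E (length ns)"
    "list_all2 (\<lambda>n q. Poly_Mapping.keys q \<subseteq> tree_monomials E n) ns qs"
    using assms(1) by (auto simp: composable_def)
  have "list_all2 (\<lambda>n s. s \<in> tree_monomials E n) ns ss"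
    using *(3) **(2) by (fastforce simp: list_all2_conv_all_nth)
  with * ** that show ?thesis by blast
qed

lemma free_op_comp_closed:
  fixes p :: "'g tree \<Rightarrow>\<^sub>0 'k::field"
  assumes "composable (free_operad E) ns p qs"
  shows "Poly_Mapping.keys (op_comp (free_operad E) ns p qs) \<subseteq> tree_monomials E (sum_list ns)"
proof -
  have "graft ns (hd ts) (tl ts) \<in> tree_monomials E (sum_list ns)"
    if "ts \<in> listset (map Poly_Mapping.keys (p # qs))" for ts
    using assms that
  proof (rule free_composable_listset)
    fix s ss assume "ts = s # ss" "s \<in> tree_monomials E (length ns)"
      "list_all2 (\<lambda>n s. s \<in> tree_monomials E n) ns ss"
    then show ?thesis by (simp add: graft_in_tree_monomials)
  qed
  then show ?thesis
    unfolding op_comp_free by (rule order_trans[OF keys_multilinear_ext image_subsetI])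
qed

lemma free_op_act_closed:
  fixes p :: "'g tree \<Rightarrow>\<^sub>0 'k::field"
  assumes "Poly_Mapping.keys p \<subseteq> tree_monomials E n" "\<sigma> permutes {..<n}"
  shows "Poly_Mapping.keys (op_act (free_operad E) n \<sigma> p) \<subseteq> tree_monomials E n"
proof -
  have "relabel (inv_into UNIV \<sigma>) t \<in> tree_monomials E n" if "t \<in> Poly_Mapping.keys p" for t
    using relabel_in_tree_monomials[OF _ permutes_inv[OF assms(2)]] assms(1) that by blast
  then show ?thesis
    unfolding op_act_free by (intro order_trans[OF keys_lin_extend]) auto
qed

text \<open>An intersection over an empty family would be the whole type and leave the carrier. The
  ideal \<open>J\<close> supplies a member of the family; for \<open>Ins\<close> it is the kernel of
  the evaluation in K(x).\<close>

lemma operadic_ideal_generated: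
  assumes J: "operadic_ideal P J" "\<And>m. R m \<subseteq> J m" and P: "P = free_operad E"
  shows "operadic_ideal P (ideal_generated_by P R)"
  unfolding operadic_ideal_def
proof (intro conjI allI ballI impI)
  fix n
  show "subspace_of (ideal_generated_by P R n) (op_space P n)"
    unfolding ideal_generated_by_def P op_space_free
  proof (rule subspace_Inter)
    show "{J n |J. operadic_ideal (free_operad E) J \<and> (\<forall>m. R m \<subseteq> J m)} \<noteq> {}"
      using J P by blast
  qed (auto simp: operadic_ideal_def)
next
  fix ns p qs
  assume "composable P ns p qs \<and> (p \<in> ideal_generated_by P R (length ns) \<or>
            (\<exists>i<length ns. qs ! i \<in> ideal_generated_by P R (ns ! i)))"
  then show "op_comp P ns p qs \<in> ideal_generated_by P R (sum_list ns)"
    unfolding ideal_generated_by_def operadic_ideal_def by blast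
next
  fix n \<sigma> p
  assume "p \<in> ideal_generated_by P R n" "\<sigma> permutes {..<n}"
  then show "op_act P n \<sigma> p \<in> ideal_generated_by P R n"
    unfolding ideal_generated_by_def operadic_ideal_def by blast
qed

lemma ideal_generated_by_superset: "R n \<subseteq> ideal_generated_by P R n"
  by (auto simp: ideal_generated_by_def)

lemma ideal_generated_by_subset:
  "operadic_ideal P J \<Longrightarrow> (\<And>m. R m \<subseteq> J m) \<Longrightarrow> ideal_generated_by P R n \<subseteq> J n"
  by (auto simp: ideal_generated_by_def)

section \<open>Evaluation in a commutative algebra acting by scalars\<close>

text \<open>A tree acts on a line over \<open>K(x)\<close> as multiplication by the product of the scalars of its vertices.\<close>

primrec weight :: "('g \<Rightarrow> 'c::comm_monoid_mult) \<Rightarrow> 'g tree \<Rightarrow> 'c" where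
  "weight w (Leaf i) = 1"
| "weight w (Node g ts) = w g * prod_list (map (weight w) ts)"

lemma prod_list_mult:
  "prod_list (map (\<lambda>x. f x * g x) xs) = prod_list (map f xs) * prod_list (map g xs :: 'c::comm_monoid_mult list)"
  by (induction xs) (auto simp: ac_simps)

lemma weight_subst_tree:
  "weight w (subst_tree f t) = weight w t * prod_list (map (\<lambda>i. weight w (f i)) (leaves t))"
proof (induction t)
  case (Node g ts)
  have "prod_list (map (\<lambda>i. weight w (f i)) (concat (map leaves ts)))
      = prod_list (map (\<lambda>t. prod_list (map (\<lambda>i. weight w (f i)) (leaves t))) ts)"
    by (induction ts) auto
  moreover have "prod_list (map (weight w) (map (subst_tree f) ts))
      = prod_list (map (\<lambda>t. weight w t * prod_list (map (\<lambda>i. weight w (f i)) (leaves t))) ts)"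
    using Node by (intro arg_cong[of _ _ prod_list]) auto
  ultimately show ?case by (simp add: prod_list_mult mult.assoc)
qed simp

lemma weight_relabel [simp]: "weight w (relabel h t) = weight w t"
proof -
  have "prod_list (map (\<lambda>i. 1 :: 'a) xs) = 1" for xs :: "nat list" by (induction xs) auto
  then show ?thesis by (simp add: relabel_def weight_subst_tree)
qed

text \<open>Every number below \<open>length ts\<close> labels exactly one leaf of \<open>t\<close>,
  so by commutativity the product over the leaves is the product over \<open>ts\<close>.\<close>

lemma weight_graft:
  assumes "t \<in> tree_monomials E (length ts)"
  shows "weight w (graft ns t ts) = weight w t * prod_list (map (weight w) ts)"
proof -
  have "prod_list (map (\<lambda>i. weight w (ts ! i)) (leaves t)) = prod_mset (image_mset (\<lambda>i. weight w (ts ! i)) (mset (leaves t)))"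
    by (simp add: prod_mset_prod_list[symmetric])
  also have "\<dots> = prod_list (map (\<lambda>i. weight w (ts ! i)) [0..<length ts])"
    using assms unfolding tree_monomials_iff
    by (simp add: prod_mset_prod_list[symmetric] del: mset_upt)
  also have "map (\<lambda>i. weight w (ts ! i)) [0..<length ts] = map (weight w) ts"
    by (rule nth_equalityI) auto
  finally show ?thesis by (simp add: graft_def weight_subst_tree)
qed

section \<open>Evaluation of linear combinations of trees in K(x)\<close>

definition const_fract :: "'k::field \<Rightarrow> 'k poly fract" where
  "const_fract c = to_fract [:c:]"

lemma const_fract_simps [simp]:
  "const_fract 0 = 0" "const_fract 1 = 1" "const_fract (c + d) = const_fract c + const_fract d"
  "const_fract (c * d) = const_fract c * const_fract d" "const_fract (- c) = - const_fract c"
  by (simp_all add: const_fract_def flip: to_fract_add to_fract_mult to_fract_uminus one_pCons)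

definition evaluate :: "('a \<Rightarrow> 'k poly fract) \<Rightarrow> ('a \<Rightarrow>\<^sub>0 'k::field) \<Rightarrow> 'k poly fract" where
  "evaluate C p = (\<Sum>t\<in>Poly_Mapping.keys p. const_fract (Poly_Mapping.lookup p t) * C t)"

lemma evaluate_superset:
  assumes "finite A" "Poly_Mapping.keys p \<subseteq> A"
  shows "evaluate C p = (\<Sum>t\<in>A. const_fract (Poly_Mapping.lookup p t) * C t)"
  unfolding evaluate_def
  by (rule sum.mono_neutral_left) (use assms in \<open>auto simp: in_keys_iff\<close>)

lemma evaluate_0 [simp]: "evaluate C 0 = 0"
  by (simp add: evaluate_def)

lemma evaluate_add [simp]: "evaluate C (p + q) = evaluate C p + evaluate C q"
proof -
  let ?A = "Poly_Mapping.keys p \<union> Poly_Mapping.keys q"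
  show ?thesis
    by (subst (1 2 3) evaluate_superset[where A = ?A])
       (auto simp: keys_add lookup_add sum.distrib distrib_right)
qed

lemma evaluate_scale [simp]: "evaluate C (scale c p) = const_fract c * evaluate C p"
  using evaluate_superset[of "Poly_Mapping.keys p" "scale c p" C]
  by (simp add: keys_scale evaluate_def sum_distrib_left mult.assoc)

lemma evaluate_uminus [simp]: "evaluate C (- p) = - evaluate C p"
  using evaluate_scale[of C "-1" p] by (simp add: scale_uminus)

lemma evaluate_diff [simp]: "evaluate C (p - q) = evaluate C p - evaluate C q"
  using evaluate_add[of C p "- q"] by simp

lemma evaluate_single [simp]: "evaluate C (Poly_Mapping.single t c) = const_fract c * C t"
  by (simp add: evaluate_def)

lemma evaluate_sum: "evaluate C (\<Sum>i\<in>A. f i) = (\<Sum>i\<in>A. evaluate C (f i))"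
  by (induction A rule: infinite_finite_induct) auto

lemma evaluate_lin_extend:
  "evaluate C (lin_extend G p) = evaluate (\<lambda>t. evaluate C (G t)) p"
  by (simp add: lin_extend_def evaluate_sum) (simp add: evaluate_def)

lemma evaluate_cong:
  "(\<And>t. t \<in> Poly_Mapping.keys p \<Longrightarrow> C t = D t) \<Longrightarrow> evaluate C p = evaluate D p"
  by (simp add: evaluate_def)

lemma evaluate_mult_right: "evaluate (\<lambda>t. C t * a) p = evaluate C p * a"
  by (simp add: evaluate_def sum_distrib_right mult.assoc)

text \<open>Evaluation turns composition into multiplication. The factor \<open>a\<close> serves the
  induction: fixing the key t of the first argument replaces it by \<open>a * D t\<close>.\<close>

lemma evaluate_multilinear_ext:
  assumes "\<And>ts. ts \<in> listset (map Poly_Mapping.keys ps) \<Longrightarrow> C (F ts) = a * prod_list (map D ts)"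
  shows "evaluate C (multilinear_ext F ps) = a * prod_list (map (evaluate D) ps)"
  using assms
proof (induction ps arbitrary: F a)
  case (Cons p ps)
  have "evaluate C (multilinear_ext (\<lambda>ts. F (t # ts)) ps) = D t * (a * prod_list (map (evaluate D) ps))"
    if "t \<in> Poly_Mapping.keys p" for t
  proof -
    have "evaluate C (multilinear_ext (\<lambda>ts. F (t # ts)) ps) = (a * D t) * prod_list (map (evaluate D) ps)"
      by (rule Cons.IH) (use Cons.prems that in \<open>auto simp: set_Cons_def mult.assoc\<close>)
    then show ?thesis by (simp add: ac_simps)
  qed
  then have "evaluate C (multilinear_ext F (p # ps)) = evaluate (\<lambda>t. D t * (a * prod_list (map (evaluate D) ps))) p"
    unfolding multilinear_ext_Cons evaluate_lin_extend by (rule evaluate_cong)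
  also have "\<dots> = evaluate D p * (a * prod_list (map (evaluate D) ps))"
    by (rule evaluate_mult_right)
  finally show ?case by (simp del: multilinear_ext_Cons add: ac_simps)
qed simp

text \<open>The arity n part of the kernel of the action by scalars on a line over K(x).\<close>

definition weight_ideal :: "(nat \<Rightarrow> 'g set) \<Rightarrow> ('g \<Rightarrow> 'k poly fract) \<Rightarrow> nat \<Rightarrow> ('g tree \<Rightarrow>\<^sub>0 'k::field) set" where
  "weight_ideal E w n = {p. Poly_Mapping.keys p \<subseteq> tree_monomials E n \<and> evaluate (weight w) p = 0}"

text \<open>The value of a composite is the product of the values of its arguments, so one vanishing
  argument suffices; relabelling leaves does not change weights.\<close>

lemma operadic_ideal_weight_ideal:
  fixes E :: "nat \<Rightarrow> 'g set" and w :: "'g \<Rightarrow> 'k::field poly fract"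
  shows "operadic_ideal (free_operad E) (weight_ideal E w)"
  unfolding operadic_ideal_def
proof (intro conjI allI ballI impI)
  fix n
  have "Poly_Mapping.keys (p + q) \<subseteq> X" if "Poly_Mapping.keys p \<subseteq> X" "Poly_Mapping.keys q \<subseteq> X"
    for p q :: "'g tree \<Rightarrow>\<^sub>0 'k" and X
    using that keys_add[of p q] by blast
  moreover have "Poly_Mapping.keys (scale c p) \<subseteq> X" if "Poly_Mapping.keys p \<subseteq> X"
    for p :: "'g tree \<Rightarrow>\<^sub>0 'k" and c X
    using that keys_scale[of c p] by blast
  ultimately show "subspace_of (weight_ideal E w n) (op_space (free_operad E) n)"
    unfolding op_space_free subspace_free_space_iff weight_ideal_def by (simp add: Collect_mono_iff)
next
  fix ns and p :: "'g tree \<Rightarrow>\<^sub>0 'k" and qs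
  assume *: "composable (free_operad E) ns p qs \<and>
      (p \<in> weight_ideal E w (length ns) \<or> (\<exists>i<length ns. qs ! i \<in> weight_ideal E w (ns ! i)))"
  have "evaluate (weight w) (op_comp (free_operad E) ns p qs) = 1 * prod_list (map (evaluate (weight w)) (p # qs))"
    unfolding op_comp_free
  proof (rule evaluate_multilinear_ext)
    fix ts assume "ts \<in> listset (map Poly_Mapping.keys (p # qs))"
    then obtain s ss where "ts = s # ss" "s \<in> tree_monomials E (length ns)"
      "list_all2 (\<lambda>n s. s \<in> tree_monomials E n) ns ss"
      using free_composable_listset[OF conjunct1[OF *]] by blast
    then show "weight w (graft ns (hd ts) (tl ts)) = 1 * prod_list (map (weight w) ts)"
      by (auto simp: weight_graft[of _ E] dest: list_all2_lengthD)
  qed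
  also have "\<dots> = 0"
  proof -
    have "length qs = length ns" using * by (auto simp: composable_def dest: list_all2_lengthD)
    then have "\<exists>q\<in>set (p # qs). evaluate (weight w) q = 0"
      using * by (auto simp: weight_ideal_def)
    then show ?thesis by (subst mult_1_left, subst prod_list_zero_iff) force
  qed
  finally show "op_comp (free_operad E) ns p qs \<in> weight_ideal E w (sum_list ns)"
    using * free_op_comp_closed[of E ns p qs] by (simp add: weight_ideal_def)
next
  fix n \<sigma> and p :: "'g tree \<Rightarrow>\<^sub>0 'k"
  assume "p \<in> weight_ideal E w n" "\<sigma> permutes {..<n}"
  then show "op_act (free_operad E) n \<sigma> p \<in> weight_ideal E w n"
    using free_op_act_closed[of p E n \<sigma>] by (simp add: weight_ideal_def evaluate_lin_extend)
qed

section \<open>The weights of the generators of \<open>Ins\<close> and the check of its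
  relations\<close>

primrec ins_weight :: "'k::field ins_gen \<Rightarrow> 'k poly fract" where
  "ins_weight Mu = 1"
| "ins_weight (Ups n) = to_fract (monom 1 n)"
| "ins_weight (Inv l) = inverse (evaluate (\<lambda>n. to_fract (monom 1 n)) l)"

text \<open>The value is the image of the polynomial whose coefficient sequence is \<open>l\<close>,
  and a polynomial ring embeds into its fraction field.\<close>

lemma evaluate_monom_eq_0_iff: "evaluate (\<lambda>n. to_fract (monom 1 n)) l = 0 \<longleftrightarrow> l = 0"
proof
  let ?p = "\<Sum>n\<in>Poly_Mapping.keys l. monom (Poly_Mapping.lookup l n) n"
  have to_fract_sum: "to_fract (\<Sum>n\<in>A. f n) = (\<Sum>n\<in>A. to_fract (f n))" for A :: "nat set" and f :: "nat \<Rightarrow> 'a poly"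
    by (induction A rule: infinite_finite_induct) auto
  have "evaluate (\<lambda>n. to_fract (monom 1 n)) l = to_fract ?p"
    by (simp add: evaluate_def const_fract_def to_fract_sum smult_monom flip: to_fract_mult)
  moreover have "coeff ?p n = Poly_Mapping.lookup l n" for n
    by (auto simp: coeff_sum in_keys_iff if_distrib cong: if_cong)
  moreover assume "evaluate (\<lambda>n. to_fract (monom 1 n)) l = 0"
  ultimately show "l = 0" by (intro poly_mapping_eqI) (metis coeff_0 lookup_zero to_fract_eq_0_iff)
qed simp

lemma ins_generators_simps [simp]:
  "Mu \<in> ins_generators (Suc (Suc 0))" "Ups i \<in> ins_generators 0"
  "Inv l \<in> ins_generators (Suc 0) \<longleftrightarrow> l \<noteq> 0"
  by (auto simp: ins_generators_def)

text \<open>The unit relations hold because x^0 = 1, associativity because both trees have weight 1,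
  and the relation for \<open>l\<close> reads a * inverse a = 1 with a non-zero by
  \<open>evaluate_monom_eq_0_iff\<close>.\<close>

lemma ins_relations_subset_weight_ideal: "ins_relations n \<subseteq> weight_ideal ins_generators ins_weight n"
proof
  fix p :: "'a ins_gen tree \<Rightarrow>\<^sub>0 'a"
  assume p: "p \<in> ins_relations n"
  have diff: "x - y \<in> weight_ideal ins_generators ins_weight n"
    if "Poly_Mapping.keys x \<subseteq> tree_monomials ins_generators n"
      "Poly_Mapping.keys y \<subseteq> tree_monomials ins_generators n"
      "evaluate (weight ins_weight) x = evaluate (weight ins_weight) y"
    for x y :: "'a ins_gen tree \<Rightarrow>\<^sub>0 'a"
    using that keys_diff[of x y] by (auto simp: weight_ideal_def)
  have mono0: "to_fract (monom 1 0) = (1 :: 'a poly fract)" by (simp add: monom_0 flip: one_pCons)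
  consider "n = 1" "p = basis (Node Mu [Node (Ups 0) [], Leaf 0]) - basis (Leaf 0)"
    | "n = 1" "p = basis (Node Mu [Leaf 0, Node (Ups 0) []]) - basis (Leaf 0)"
    | l where "n = 1" "l \<noteq> 0" "p = ins_inverse_relation l"
    | "n = 3" "p = basis (Node Mu [Node Mu [Leaf 0, Leaf 1], Leaf 2])
           - basis (Node Mu [Leaf 0, Node Mu [Leaf 1, Leaf 2]])"
    using p by (auto simp: ins_relations_def split: if_splits)
  then show "p \<in> weight_ideal ins_generators ins_weight n"
  proof cases
    case (3 l)
    let ?T = "\<lambda>i. Node Mu [Node (Ups i) [], Node (Inv l) [Leaf 0]]"
    have "Poly_Mapping.keys (\<Sum>i\<in>Poly_Mapping.keys l. Poly_Mapping.single (?T i) (Poly_Mapping.lookup l i))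
        \<subseteq> tree_monomials ins_generators 1"
      by (rule order_trans[OF keys_sum]) (use 3 in \<open>auto simp: tree_monomials_def\<close>)
    moreover have "evaluate (weight ins_weight) (\<Sum>i\<in>Poly_Mapping.keys l. Poly_Mapping.single (?T i) (Poly_Mapping.lookup l i))
       = evaluate (\<lambda>n. to_fract (monom 1 n)) l * inverse (evaluate (\<lambda>n. to_fract (monom 1 n)) l)"
      unfolding evaluate_sum
      by (simp add: evaluate_def[of _ l] sum_distrib_right mult.assoc)
    ultimately show ?thesis
      unfolding 3 ins_inverse_relation_def
      by (intro diff[unfolded 3(1)])
         (use 3 evaluate_monom_eq_0_iff[of l] in \<open>auto simp: tree_monomials_def\<close>)
  next
    case 1
    show ?thesis unfolding 1(2) by (rule diff) (simp_all add: 1(1) tree_monomials_def mono0 lessThan_Suc)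
  next
    case 2
    show ?thesis unfolding 2(2) by (rule diff) (simp_all add: 2(1) tree_monomials_def mono0 lessThan_Suc)
  next
    case 4
    show ?thesis unfolding 4(2) by (rule diff) (auto simp: 4(1) tree_monomials_def)
  qed
qed

section \<open>The ideal of relations of \<open>Ins\<close>, and why it is proper\<close>

abbreviation ins_ideal :: "nat \<Rightarrow> ('k::field ins_gen tree \<Rightarrow>\<^sub>0 'k) set" where
  "ins_ideal \<equiv> ideal_generated_by (free_operad ins_generators) ins_relations"

lemma operadic_ideal_ins_ideal: "operadic_ideal (free_operad ins_generators) ins_ideal"
  by (rule operadic_ideal_generated[OF operadic_ideal_weight_ideal ins_relations_subset_weight_ideal refl])

text \<open>The identity operation acts as 1 on the line over K(x), whereas everything in the ideal
  acts as 0.\<close>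

lemma Leaf_notin_ins_ideal: "basis (Leaf 0) \<notin> ins_ideal 1"
proof
  assume "basis (Leaf 0) \<in> (ins_ideal 1 :: ('a ins_gen tree \<Rightarrow>\<^sub>0 'a) set)"
  then have "basis (Leaf 0) \<in> (weight_ideal ins_generators ins_weight 1 :: ('a ins_gen tree \<Rightarrow>\<^sub>0 'a) set)"
    using ideal_generated_by_subset[OF operadic_ideal_weight_ideal ins_relations_subset_weight_ideal] by blast
  then show False by (simp add: weight_ideal_def)
qed

lemma subspace_ins_ideal: "subspace_of (ins_ideal n) (free_space (tree_monomials ins_generators n))"
  using operadic_ideal_ins_ideal by (auto simp: operadic_ideal_def)

abbreviation ins_class :: "nat \<Rightarrow> ('k::field ins_gen tree \<Rightarrow>\<^sub>0 'k) \<Rightarrow> ('k ins_gen tree \<Rightarrow>\<^sub>0 'k) set" where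
  "ins_class n p \<equiv> ins_ideal n +>\<^bsub>free_space (tree_monomials ins_generators n)\<^esub> p"

lemma op_space_Ins [simp]:
    "op_space Ins n = quotient_space (free_space (tree_monomials ins_generators n)) (ins_ideal n)"
  and op_id_Ins [simp]: "op_id Ins = ins_class 1 (basis (Leaf 0))"
  and op_comp_Ins:
    "op_comp Ins ns X Ys = ins_class (sum_list ns) (op_comp (free_operad ins_generators) ns (repr X) (map repr Ys))"
  and op_act_Ins:
    "op_act Ins n \<sigma> X = ins_class n (op_act (free_operad ins_generators) n \<sigma> (repr X))"
  by (simp_all add: Ins_def presented_operad_def quotient_operad_def del: op_comp_free op_act_free)

lemma Leaf_in_tree_monomials: "Leaf 0 \<in> tree_monomials E (Suc 0)"
  by (auto simp: tree_monomials_def)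

lemma Ins_nonzero: "\<not> is_zero_operad (Ins :: ('k::field, ('k ins_gen tree \<Rightarrow>\<^sub>0 'k) set) operad)"
proof
  assume "is_zero_operad (Ins :: ('k, ('k ins_gen tree \<Rightarrow>\<^sub>0 'k) set) operad)"
  then have "carrier (op_space (Ins :: ('k, ('k ins_gen tree \<Rightarrow>\<^sub>0 'k) set) operad) 1) = {ins_ideal 1}"
    by (simp add: is_zero_operad_def is_zero_space_def zero_quotient[OF subspace_ins_ideal] del: One_nat_def)
  moreover have "ins_class 1 (basis (Leaf 0)) \<in> carrier (op_space (Ins :: ('k, ('k ins_gen tree \<Rightarrow>\<^sub>0 'k) set) operad) 1)"
    unfolding op_space_Ins
    by (rule coset_in_quotient[OF subspace_ins_ideal]) (simp add: Leaf_in_tree_monomials)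
  ultimately show False
    using coset_eq_self_iff[OF subspace_ins_ideal] Leaf_notin_ins_ideal by blast
qed

section \<open>Composition in Ins\<close>

text \<open>The arguments are exchanged one at a time from the left. Two consecutive hybrid lists
  differ in slot k only, so by linearity in that slot their difference is a single value of the kind
  covered by \<open>step\<close>.\<close>

lemma multilinear_ext_telescope:
  assumes I: "subspace_of I (free_space X)" and len: "length qs = length qs'"
    and step: "\<And>k. k < length qs \<Longrightarrow>
      multilinear_ext F (us @ take k qs' @ (qs ! k - qs' ! k) # drop (Suc k) qs) \<in> I"
  shows "multilinear_ext F (us @ qs) - multilinear_ext F (us @ qs') \<in> I"
proof -
  have "multilinear_ext F (us @ qs) - multilinear_ext F (us @ take k qs' @ drop k qs) \<in> I"
    if "k \<le> length qs" for k
    using that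
  proof (induction k)
    case 0
    then show ?case using subspaceD(2)[OF I] by simp
  next
    case (Suc k)
    let ?M = "\<lambda>x. multilinear_ext F ((us @ take k qs') @ x # drop (Suc k) qs)"
    have "drop k qs = qs ! k # drop (Suc k) qs" using Suc by (simp add: Cons_nth_drop_Suc)
    then have "multilinear_ext F (us @ qs) - ?M (qs ! k) \<in> I" using Suc by simp
    moreover have "?M (qs ! k - qs' ! k) \<in> I" using step[of k] Suc by simp
    then have "?M (qs ! k) - ?M (qs' ! k) \<in> I" unfolding multilinear_ext_diff .
    ultimately have "(multilinear_ext F (us @ qs) - ?M (qs ! k)) + (?M (qs ! k) - ?M (qs' ! k)) \<in> I"
      by (rule subspaceD(3)[OF I])
    then show ?case using Suc len by (simp add: take_Suc_conv_app_nth)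
  qed
  from this[of "length qs"] show ?thesis using len by simp
qed

text \<open>Composition descends to the quotient by an operadic ideal: each telescoping term has one
  argument in the ideal.\<close>

lemma operadic_ideal_comp_cong:
  fixes p p' :: "'g tree \<Rightarrow>\<^sub>0 'k::field"
  assumes I: "operadic_ideal (free_operad E) I"
    and pq: "composable (free_operad E) ns p qs" and pq': "composable (free_operad E) ns p' qs'"
    and p: "p - p' \<in> I (length ns)" and q: "\<And>i. i < length ns \<Longrightarrow> qs ! i - qs' ! i \<in> I (ns ! i)"
  shows "op_comp (free_operad E) ns p qs - op_comp (free_operad E) ns p' qs' \<in> I (sum_list ns)"
proof -
  have sub: "subspace_of (I n) (free_space (tree_monomials E n))" for n
    using I by (auto simp: operadic_ideal_def)
  have len: "length qs = length ns" "length qs' = length ns"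
    using pq pq' by (auto simp: composable_def dest: list_all2_lengthD)
  have keys: "Poly_Mapping.keys p \<subseteq> tree_monomials E (length ns)"
      "Poly_Mapping.keys p' \<subseteq> tree_monomials E (length ns)"
    using pq pq' by (auto simp: composable_def)
  have keys_q: "Poly_Mapping.keys (qs ! i) \<subseteq> tree_monomials E (ns ! i)"
      "Poly_Mapping.keys (qs' ! i) \<subseteq> tree_monomials E (ns ! i)" if "i < length ns" for i
    using pq pq' that by (auto simp: composable_def list_all2_conv_all_nth)
  let ?F = "\<lambda>ts. graft ns (hd ts) (tl ts)"
  have in_I: "multilinear_ext ?F (r # rs) \<in> I (sum_list ns)"
    if "composable (free_operad E) ns r rs" "r \<in> I (length ns) \<or> (\<exists>i<length ns. rs ! i \<in> I (ns ! i))" for r rs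
    using I that unfolding operadic_ideal_def op_comp_free by blast
  have "multilinear_ext ?F ([] @ (p # qs)) - multilinear_ext ?F ([] @ (p' # qs')) \<in> I (sum_list ns)"
  proof (rule multilinear_ext_telescope[OF sub])
    fix k assume k: "k < length (p # qs)"
    show "multilinear_ext ?F ([] @ take k (p' # qs') @ ((p # qs) ! k - (p' # qs') ! k) # drop (Suc k) (p # qs))
        \<in> I (sum_list ns)"
    \<comment> \<open>Slot 0 holds the outer operation, slot \<open>Suc j\<close> the j-th inner
      one.\<close>
    proof (cases k)
      case 0
      have "composable (free_operad E) ns (p - p') qs"
        using pq subspaceD(1)[OF sub p] by (auto simp: composable_def)
      then show ?thesis unfolding 0 using in_I[of "p - p'" qs] p by simp
    next
      case (Suc j)
      \<comment> \<open>The hybrid list of inner operations: already exchanged before j, the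
        difference at j, still original after j.\<close>
      let ?rs = "take j qs' @ (qs ! j - qs' ! j) # drop (Suc j) qs"
      have j: "j < length ns" using k Suc len by simp
      have nth: "?rs ! i = (if i < j then qs' ! i else if i = j then qs ! j - qs' ! j else qs ! i)"
        if "i < length ns" for i
        using that j len by (auto simp: nth_append nth_Cons')
      have "composable (free_operad E) ns p' ?rs"
        unfolding composable_def op_space_free list_all2_conv_all_nth
        using keys keys_q subspaceD(1)[OF sub q[OF j]] len j by (auto simp: nth)
      moreover have "?rs ! j \<in> I (ns ! j)" using nth[OF j] q[OF j] by simp
      ultimately show ?thesis using in_I[of p' ?rs] j Suc by auto
    qed
  qed (use len in simp)
  then show ?thesis by (simp del: multilinear_ext_Cons)
qed

lemma composable_Ins_repr:
  assumes "composable Ins ns X Ys"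
  shows "composable (free_operad ins_generators) ns (repr X) (map repr Ys)"
proof -
  have len: "length Ys = length ns" using assms by (auto simp: composable_def dest: list_all2_lengthD)
  have "Poly_Mapping.keys (repr X) \<subseteq> tree_monomials ins_generators (length ns)"
    by (rule keys_repr[OF subspace_ins_ideal]) (use assms in \<open>simp add: composable_def\<close>)
  moreover have "Poly_Mapping.keys (repr (Ys ! i)) \<subseteq> tree_monomials ins_generators (ns ! i)"
    if "i < length ns" for i
    by (rule keys_repr[OF subspace_ins_ideal])
       (use assms that in \<open>simp add: composable_def list_all2_conv_all_nth\<close>)
  ultimately show ?thesis by (simp add: composable_def list_all2_conv_all_nth len)
qed

lemma op_comp_Ins_closed:
  fixes X :: "('k::field ins_gen tree \<Rightarrow>\<^sub>0 'k) set"
  assumes "composable Ins ns X Ys"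
  shows "op_comp Ins ns X Ys \<in> carrier (op_space Ins (sum_list ns))"
  unfolding op_comp_Ins op_space_Ins
  by (rule coset_in_quotient[OF subspace_ins_ideal free_op_comp_closed[OF composable_Ins_repr[OF assms]]])

lemma op_act_Ins_closed:
  fixes X :: "('k::field ins_gen tree \<Rightarrow>\<^sub>0 'k) set"
  assumes "X \<in> carrier (op_space Ins n)" "\<sigma> permutes {..<n}"
  shows "op_act Ins n \<sigma> X \<in> carrier (op_space Ins n)"
  unfolding op_act_Ins op_space_Ins
  by (rule coset_in_quotient[OF subspace_ins_ideal free_op_act_closed])
     (use assms keys_repr[OF subspace_ins_ideal] in auto)

text \<open>The representatives picked by \<open>repr\<close> differ from \<open>p\<close> and
  \<open>qs\<close> by elements of the ideal. Composites in \<open>Ins\<close> can thus be computed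
  on explicit trees.\<close>

lemma op_comp_Ins_class:
  fixes p :: "'k::field ins_gen tree \<Rightarrow>\<^sub>0 'k"
  assumes "composable (free_operad ins_generators) ns p qs"
  shows "op_comp Ins ns (ins_class (length ns) p) (map2 ins_class ns qs)
    = ins_class (sum_list ns) (op_comp (free_operad ins_generators) ns p qs)"
proof -
  have len: "length qs = length ns" using assms by (auto simp: composable_def dest: list_all2_lengthD)
  have "composable Ins ns (ins_class (length ns) p) (map2 ins_class ns qs)"
    using assms
    by (auto simp: composable_def list_all2_conv_all_nth coset_in_quotient[OF subspace_ins_ideal])
  note c = composable_Ins_repr[OF this]
  show ?thesis
    unfolding op_comp_Ins coset_eq_iff[OF subspace_ins_ideal]
    by (rule operadic_ideal_comp_cong[OF operadic_ideal_ins_ideal c assms])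
       (simp_all add: repr_coset[OF subspace_ins_ideal] len)
qed

section \<open>Tensor powers\<close>

context
  fixes V :: "('k::field, 'v) module"
  assumes V: "vector_space_on V"
begin

interpretation Module.module "cring_class_ops :: 'k ring" V by (rule V)

lemma multilinear_relations_subset:
  "multilinear_relations V n \<subseteq> {p. Poly_Mapping.keys p \<subseteq> tuples V n}"
proof -
  have "us @ (x \<oplus>\<^bsub>V\<^esub> y) # ws \<in> tuples V n" "us @ y # ws \<in> tuples V n"
    if "us @ x # ws \<in> tuples V n" "y \<in> carrier V" for us x y ws
    using that by (auto simp: tuples_def)
  moreover have "us @ (c \<odot>\<^bsub>V\<^esub> x) # ws \<in> tuples V n" if "us @ x # ws \<in> tuples V n" for us x ws c
    using that by (auto simp: tuples_def carrier_class)
  ultimately show ?thesis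
    unfolding multilinear_relations_def
    by (auto dest!: subsetD[OF keys_diff] split: if_splits)
qed

lemma subspace_tensor_kernel: "subspace_of (tensor_kernel V n) (free_space (tuples V n))"
  unfolding tensor_kernel_def by (rule subspace_span[OF multilinear_relations_subset])

text \<open>An empty tuple has no slot in which to state a multilinear relation. So the zeroth
  tensor power is the ground field, and its elements have unique representatives.\<close>

lemma tensor_kernel_0: "tensor_kernel V 0 = {0}"
proof -
  have "multilinear_relations V 0 = {}"
    by (auto simp: multilinear_relations_def tuples_def)
  moreover have "subspace_of {0} (free_space (tuples V 0) :: ('k, 'v list \<Rightarrow>\<^sub>0 'k) module)"
    by (simp add: subspace_free_space_iff)
  ultimately show ?thesis
    using span_minimal[of "{0}" "free_space (tuples V 0)" "{}"] subspaceD(2)[OF subspace_tensor_kernel[of 0]]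
    by (auto simp: tensor_kernel_def)
qed

text \<open>Injectivity of the canonical map from V to its first tensor power, obtained from a
  linear map back to V.\<close>

lemma basis_notin_tensor_kernel:
  assumes v: "v \<in> carrier V" "basis [v] \<in> tensor_kernel V 1"
  shows "v = \<zero>\<^bsub>V\<^esub>"
proof -
  let ?T = "tuples V 1"
  have T: "hd vs \<in> carrier V" if "vs \<in> ?T" for vs
    using that by (cases vs) (auto simp: tuples_def)
  \<comment> \<open>The linear extension of [x] \<mapsto> x, with values in V; on tuples of length
    1, \<open>hd\<close> is the only entry.\<close>
  define \<theta> where "\<theta> p = (\<Oplus>\<^bsub>V\<^esub>vs\<in>Poly_Mapping.keys p. Poly_Mapping.lookup p vs \<odot>\<^bsub>V\<^esub> hd vs)"
    for p :: "'v list \<Rightarrow>\<^sub>0 'k"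
  have smc: "c \<odot>\<^bsub>V\<^esub> x \<in> carrier V" if "x \<in> carrier V" for c :: 'k and x
    using that by (simp add: carrier_class)
  have superset: "\<theta> p = (\<Oplus>\<^bsub>V\<^esub>vs\<in>A. Poly_Mapping.lookup p vs \<odot>\<^bsub>V\<^esub> hd vs)"
    if "finite A" "Poly_Mapping.keys p \<subseteq> A" "A \<subseteq> ?T" for p A
    unfolding \<theta>_def
  proof (rule add.finprod_mono_neutral_cong_left[OF that(1,2)])
    fix i assume "i \<in> A - Poly_Mapping.keys p"
    then show "Poly_Mapping.lookup p i \<odot>\<^bsub>V\<^esub> hd i = \<zero>\<^bsub>V\<^esub>"
      using T[of i] that smult_l_null[of "hd i"] by (auto simp: in_keys_iff class_simps)
  qed (use T smc that in auto)
  have \<theta>_closed: "\<theta> p \<in> carrier V" if "Poly_Mapping.keys p \<subseteq> ?T" for p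
    unfolding \<theta>_def using that T smc by (intro finsum_closed) auto
  have \<theta>_add: "\<theta> (p + q) = \<theta> p \<oplus>\<^bsub>V\<^esub> \<theta> q"
    if "Poly_Mapping.keys p \<subseteq> ?T" "Poly_Mapping.keys q \<subseteq> ?T" for p q
  proof -
    let ?A = "Poly_Mapping.keys p \<union> Poly_Mapping.keys q"
    have A: "hd vs \<in> carrier V" if "vs \<in> ?A" for vs using that T \<open>Poly_Mapping.keys p \<subseteq> ?T\<close> \<open>Poly_Mapping.keys q \<subseteq> ?T\<close> by auto
    have "\<theta> (p + q) = (\<Oplus>\<^bsub>V\<^esub>vs\<in>?A. Poly_Mapping.lookup (p + q) vs \<odot>\<^bsub>V\<^esub> hd vs)"
      by (rule superset) (use that keys_add[of p q] in auto)
    also have "\<dots> = (\<Oplus>\<^bsub>V\<^esub>vs\<in>?A. Poly_Mapping.lookup p vs \<odot>\<^bsub>V\<^esub> hd vs \<oplus>\<^bsub>V\<^esub> Poly_Mapping.lookup q vs \<odot>\<^bsub>V\<^esub> hd vs)"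
    proof (rule finsum_cong')
      fix vs assume "vs \<in> ?A"
      from A[OF this] show "Poly_Mapping.lookup (p + q) vs \<odot>\<^bsub>V\<^esub> hd vs
          = Poly_Mapping.lookup p vs \<odot>\<^bsub>V\<^esub> hd vs \<oplus>\<^bsub>V\<^esub> Poly_Mapping.lookup q vs \<odot>\<^bsub>V\<^esub> hd vs"
        using smult_l_distr[of "Poly_Mapping.lookup p vs" "Poly_Mapping.lookup q vs" "hd vs"]
        by (simp add: lookup_add carrier_class class_simps)
    qed (use A smc in auto)
    also have "\<dots> = (\<Oplus>\<^bsub>V\<^esub>vs\<in>?A. Poly_Mapping.lookup p vs \<odot>\<^bsub>V\<^esub> hd vs)
        \<oplus>\<^bsub>V\<^esub> (\<Oplus>\<^bsub>V\<^esub>vs\<in>?A. Poly_Mapping.lookup q vs \<odot>\<^bsub>V\<^esub> hd vs)"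
      by (rule finsum_addf) (use A smc in auto)
    also have "\<dots> = \<theta> p \<oplus>\<^bsub>V\<^esub> \<theta> q"
      using superset[of ?A p] superset[of ?A q] that by simp
    finally show ?thesis .
  qed
  have \<theta>_single: "\<theta> (Poly_Mapping.single [x] c) = c \<odot>\<^bsub>V\<^esub> x" if "x \<in> carrier V" for x c
  proof (cases "c = 0")
    case True
    then show ?thesis using that smult_l_null[of x] by (simp add: \<theta>_def class_simps)
  next
    case False
    then show ?thesis using that smc[OF that] by (simp add: \<theta>_def)
  qed
  have \<theta>_scale: "\<theta> (scale c p) = c \<odot>\<^bsub>V\<^esub> \<theta> p" if p: "Poly_Mapping.keys p \<subseteq> ?T" for c p
  proof -
    have "\<theta> (scale c p) = (\<Oplus>\<^bsub>V\<^esub>vs\<in>Poly_Mapping.keys p. Poly_Mapping.lookup (scale c p) vs \<odot>\<^bsub>V\<^esub> hd vs)"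
      by (rule superset) (use that keys_scale[of c p] in auto)
    also have "\<dots> = (\<Oplus>\<^bsub>V\<^esub>vs\<in>Poly_Mapping.keys p. c \<odot>\<^bsub>V\<^esub> (Poly_Mapping.lookup p vs \<odot>\<^bsub>V\<^esub> hd vs))"
    proof (rule finsum_cong')
      fix vs assume "vs \<in> Poly_Mapping.keys p"
      then have "hd vs \<in> carrier V" using T p by auto
      then show "Poly_Mapping.lookup (scale c p) vs \<odot>\<^bsub>V\<^esub> hd vs = c \<odot>\<^bsub>V\<^esub> (Poly_Mapping.lookup p vs \<odot>\<^bsub>V\<^esub> hd vs)"
        using smult_assoc1[of c "Poly_Mapping.lookup p vs" "hd vs"] by (simp add: carrier_class class_simps)
    qed (use T smc p in auto)
    also have "\<dots> = c \<odot>\<^bsub>V\<^esub> \<theta> p"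
      unfolding \<theta>_def
      by (rule finsum_smult_ldistr[symmetric]) (use T smc p in \<open>auto simp: carrier_class\<close>)
    finally show ?thesis .
  qed
  \<comment> \<open>The kernel of \<theta>: once it is a subspace containing the relations, it
    contains the whole tensor kernel.\<close>
  define S where "S = {p. Poly_Mapping.keys p \<subseteq> ?T \<and> \<theta> p = \<zero>\<^bsub>V\<^esub>}"
  have "subspace_of S (free_space ?T)"
    unfolding subspace_free_space_iff
  proof (intro conjI ballI allI)
    fix p q assume "p \<in> S" "q \<in> S"
    then show "p + q \<in> S" using keys_add[of p q] \<theta>_add[of p q] by (auto simp: S_def)
  next
    fix p c assume "p \<in> S"
    then show "scale c p \<in> S"
      using keys_scale[of c p] \<theta>_scale[of p c] smult_r_null[of c] by (auto simp: S_def carrier_class)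
  qed (auto simp: S_def \<theta>_def)
  moreover have in_S: "p - q \<in> S" if "Poly_Mapping.keys p \<subseteq> ?T" "Poly_Mapping.keys q \<subseteq> ?T" "\<theta> p = \<theta> q" for p q
  proof -
    have keys: "Poly_Mapping.keys (p - q) \<subseteq> ?T" using that keys_diff[of p q] by blast
    have "\<theta> p = \<theta> (p - q) \<oplus>\<^bsub>V\<^esub> \<theta> q" using \<theta>_add[OF keys that(2)] by simp
    then have "\<theta> (p - q) = \<zero>\<^bsub>V\<^esub>"
      using that \<theta>_closed[OF keys] \<theta>_closed[OF that(2)] by (simp add: add.l_cancel_one')
    with keys show ?thesis by (simp add: S_def)
  qed
  have "multilinear_relations V 1 \<subseteq> S"
  proof
    fix p assume "p \<in> multilinear_relations V 1"
    \<comment> \<open>Tuples of length 1 force \<open>us\<close> and \<open>ws\<close> to be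
      empty.\<close>
    then consider x y where "x \<in> carrier V" "y \<in> carrier V"
        "p = basis [x \<oplus>\<^bsub>V\<^esub> y] - (basis [x] + basis [y])"
      | c x where "x \<in> carrier V" "p = basis [c \<odot>\<^bsub>V\<^esub> x] - Poly_Mapping.single [x] c"
      by (auto simp: multilinear_relations_def tuples_def diff_diff_eq)
    then show "p \<in> S"
    proof cases
      case 1
      have one: "1 \<odot>\<^bsub>V\<^esub> z = z" if "z \<in> carrier V" for z
        using smult_one[OF that] by (simp add: class_simps)
      have keys: "Poly_Mapping.keys (basis [z] :: 'v list \<Rightarrow>\<^sub>0 'k) \<subseteq> ?T" if "z \<in> carrier V" for z
        using that by (simp add: tuples_def)
      show ?thesis unfolding 1(3)
        by (rule in_S)
           (use 1 keys keys_add[of "basis [x]" "basis [y]"] in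
             \<open>auto simp: \<theta>_add \<theta>_single one\<close>)
    next
      case 2
      have one: "1 \<odot>\<^bsub>V\<^esub> z = z" if "z \<in> carrier V" for z
        using smult_one[OF that] by (simp add: class_simps)
      show ?thesis unfolding 2(2)
        by (rule in_S) (use 2 smc in \<open>auto simp: tuples_def \<theta>_single one\<close>)
    qed
  qed
  ultimately have "tensor_kernel V 1 \<subseteq> S" unfolding tensor_kernel_def by (rule span_minimal)
  then have "\<theta> (basis [v]) = \<zero>\<^bsub>V\<^esub>" using v by (auto simp: S_def)
  then show ?thesis using \<theta>_single[OF v(1)] smult_one[OF v(1)] by (simp add: class_simps)
qed

end

section \<open>Ins-coalgebras\<close>

text \<open>Finitely many linear conditions cannot cut an infinite-dimensional space down to zero.
  The lower bound \<open>N\<close> on the support makes the induction work: the hypothesis is used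
  twice, with disjoint supports, and a combination of the two solutions also meets the new
  condition.\<close>

lemma ex_nonzero_annihilating:
  fixes e :: "nat \<Rightarrow> 'a \<Rightarrow> 'k::field"
  assumes "finite A"
  shows "\<exists>l. l \<noteq> 0 \<and> Poly_Mapping.keys l \<subseteq> {N..} \<and>
    (\<forall>a\<in>A. (\<Sum>i\<in>Poly_Mapping.keys l. Poly_Mapping.lookup l i * e i a) = 0)"
  using assms
proof (induction A arbitrary: N)
  case empty
  have "basis N \<noteq> (0 :: nat \<Rightarrow>\<^sub>0 'k)"
    by (auto dest: arg_cong[of _ _ "\<lambda>p. Poly_Mapping.lookup p N"])
  then show ?case by (intro exI[of _ "basis N"]) auto
next
  case (insert a A)
  define ev where "ev l b = (\<Sum>i\<in>Poly_Mapping.keys l. Poly_Mapping.lookup l i * e i b)" for l b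
  have superset: "ev l b = (\<Sum>i\<in>B. Poly_Mapping.lookup l i * e i b)"
    if "finite B" "Poly_Mapping.keys l \<subseteq> B" for l b B
    unfolding ev_def by (rule sum.mono_neutral_left) (use that in \<open>auto simp: in_keys_iff\<close>)
  obtain l where l: "l \<noteq> 0" "Poly_Mapping.keys l \<subseteq> {N..}" "\<And>b. b \<in> A \<Longrightarrow> ev l b = 0"
    using insert.IH[of N] unfolding ev_def by blast
  \<comment> \<open>Beyond the whole support of \<open>l\<close>, so that the second solution
    \<open>m\<close> has disjoint support.\<close>
  define M where "M = Suc (Max (Poly_Mapping.keys l))"
  obtain m where m: "m \<noteq> 0" "Poly_Mapping.keys m \<subseteq> {M..}" "\<And>b. b \<in> A \<Longrightarrow> ev m b = 0"
    using insert.IH[of M] unfolding ev_def by blast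
  have l_less: "i < M" if "i \<in> Poly_Mapping.keys l" for i
    using that by (simp add: M_def le_imp_less_Suc)
  obtain i0 where "i0 \<in> Poly_Mapping.keys l" using l(1) by fastforce
  then have "N \<le> M" using l_less[of i0] l(2) by force
  show ?case
  proof (cases "ev l a = 0")
    case True
    then show ?thesis using l unfolding ev_def by (intro exI[of _ l]) auto
  next
    case False
    \<comment> \<open>The cross combination: its value at \<open>a\<close> is
      \<open>ev m a * ev l a - ev l a * ev m a\<close>, which is 0.\<close>
    define n where "n = scale (ev m a) l - scale (ev l a) m"
    have keys_n: "Poly_Mapping.keys n \<subseteq> Poly_Mapping.keys l \<union> Poly_Mapping.keys m"
      unfolding n_def
      using keys_diff[of "scale (ev m a) l" "scale (ev l a) m"] keys_scale[of "ev m a" l] keys_scale[of "ev l a" m]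
      by blast
    have "ev n b = ev m a * ev l b - ev l a * ev m b" for b
    proof -
      let ?B = "Poly_Mapping.keys l \<union> Poly_Mapping.keys m"
      have "ev n b = (\<Sum>i\<in>?B. Poly_Mapping.lookup n i * e i b)"
        by (rule superset) (use keys_n in auto)
      also have "\<dots> = ev m a * (\<Sum>i\<in>?B. Poly_Mapping.lookup l i * e i b)
          - ev l a * (\<Sum>i\<in>?B. Poly_Mapping.lookup m i * e i b)"
        by (simp add: n_def lookup_minus left_diff_distrib sum_subtractf sum_distrib_left mult.assoc)
      also have "\<dots> = ev m a * ev l b - ev l a * ev m b"
        using superset[of ?B l b] superset[of ?B m b] by simp
      finally show ?thesis .
    qed
    then have "ev n b = 0" if "b \<in> insert a A" for b
      using that l(3) m(3) by auto
    moreover have "n \<noteq> 0"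
    proof -
      \<comment> \<open>On the support of \<open>m\<close> the sequence \<open>l\<close> vanishes,
        so the coefficient of \<open>n\<close> is that of \<open>m\<close> times the non-zero scalar
        \<open>- ev l a\<close>.\<close>
      obtain i where i: "i \<in> Poly_Mapping.keys m" using m(1) by fastforce
      then have "i \<notin> Poly_Mapping.keys l" using m(2) l_less[of i] by force
      then have "Poly_Mapping.lookup n i \<noteq> 0"
        using i False by (auto simp: n_def lookup_minus in_keys_iff)
      then show ?thesis by auto
    qed
    moreover have "Poly_Mapping.keys n \<subseteq> {N..}"
      using keys_n l(2) m(2) \<open>N \<le> M\<close> by fastforce
    ultimately show ?thesis unfolding ev_def by blast
  qed
qed

section \<open>The coaction on representatives, and the vanishing of coalgebras\<close>

lemma linear_maps_closed: "f \<in> linear_maps A B \<Longrightarrow> x \<in> carrier A \<Longrightarrow> f x \<in> carrier B"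
  by (auto simp: linear_maps_def)

lemma op_space_Coend [simp]: "op_space (Coend V) n = hom_space V (tensor_power V n)"
  by (simp add: Coend_def)

lemma carrier_hom_space [simp]: "carrier (hom_space V W) = linear_maps V W"
  by (simp add: hom_space_def)

lemma coaction_linear:
  assumes "operad_morphism P (Coend V) \<phi>" "X \<in> carrier (op_space P n)"
  shows "\<phi> n X \<in> linear_maps V (tensor_power V n)"
proof -
  have "\<phi> n \<in> linear_maps (op_space P n) (hom_space V (tensor_power V n))"
    using assms(1) unfolding operad_morphism_def op_space_Coend by blast
  from linear_maps_closed[OF this assms(2)] show ?thesis by simp
qed

lemma operad_morphism_comp:
  "operad_morphism P Q \<phi> \<Longrightarrow> composable P ns p qs \<Longrightarrow>
    \<phi> (sum_list ns) (op_comp P ns p qs) = op_comp Q ns (\<phi> (length ns) p) (map2 \<phi> ns qs)"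
  unfolding operad_morphism_def by blast

lemma tensor_of_maps_eq:
  "tensor_of_maps W ns gs X = tensor_class W (sum_list ns)
     (lin_extend (\<lambda>vs. multilinear_ext concat (map2 (\<lambda>g v. repr (g v)) gs vs)) (repr X))"
  by (simp add: tensor_of_maps_def lin_extend_def)

text \<open>Linearity of the coaction in the operation, transferred to representatives: a
  combination of trees acts by the same combination of the vectors \<open>y i\<close>, which can
  then be computed in the free space.\<close>

lemma operad_morphism_Ins_Coend_additive:
  fixes \<phi> :: "('k::field, ('k ins_gen tree \<Rightarrow>\<^sub>0 'k) set, 'v) coaction"
  assumes V: "vector_space_on V" and \<phi>: "operad_morphism Ins (Coend V) \<phi>" and v: "v \<in> carrier V"
    and A: "finite A" "\<And>i. i \<in> A \<Longrightarrow> T i \<in> tree_monomials ins_generators n"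
    and y: "\<And>i. i \<in> A \<Longrightarrow> \<phi> n (ins_class n (basis (T i))) v = tensor_class V n (y i)"
  shows "\<phi> n (ins_class n (\<Sum>i\<in>A. Poly_Mapping.single (T i) (c i))) v
    = tensor_class V n (\<Sum>i\<in>A. scale (c i) (y i))"
proof -
  let ?Q = "quotient_space (free_space (tree_monomials ins_generators n)) (ins_ideal n) :: ('k, ('k ins_gen tree \<Rightarrow>\<^sub>0 'k) set) module"
  note K = subspace_tensor_kernel[OF V, of n]
  note I = subspace_ins_ideal
  have lin: "\<phi> n \<in> linear_maps ?Q (hom_space V (tensor_power V n))"
    using \<phi> by (auto simp: operad_morphism_def Coend_def)
  have add: "\<phi> n (ins_class n (p + q)) v = \<phi> n (ins_class n p) v \<oplus>\<^bsub>tensor_power V n\<^esub> \<phi> n (ins_class n q) v"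
    if "Poly_Mapping.keys p \<subseteq> tree_monomials ins_generators n" "Poly_Mapping.keys q \<subseteq> tree_monomials ins_generators n" for p q
    using lin coset_in_quotient[OF I that(1)] coset_in_quotient[OF I that(2)] v
    by (simp add: linear_maps_def add_quotient[OF I, symmetric] hom_space_def)
  have smult: "\<phi> n (ins_class n (scale d p)) v = d \<odot>\<^bsub>tensor_power V n\<^esub> \<phi> n (ins_class n p) v"
    if "Poly_Mapping.keys p \<subseteq> tree_monomials ins_generators n" for d p
    using lin coset_in_quotient[OF I that(1)] v
    by (simp add: linear_maps_def smult_quotient[OF I, symmetric] hom_space_def)
  have closed: "\<phi> n (ins_class n p) v \<in> carrier (tensor_power V n)"
    if "Poly_Mapping.keys p \<subseteq> tree_monomials ins_generators n" for p
    using lin coset_in_quotient[OF I that(1)] v by (auto simp: linear_maps_def hom_space_def)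
  \<comment> \<open>\<open>linear_maps\<close> has no clause about zero; the base case of the sum
    comes from the scalar 0.\<close>
  have "\<phi> n (ins_class n (scale 0 0)) v = tensor_kernel V n"
    using smult[of 0 0] closed[of 0] zero_smult_quotient[OF K] by (simp add: tensor_power_def)
  then have zero: "\<phi> n (ins_class n 0) v = tensor_kernel V n" by simp
  show ?thesis using A y
  proof (induction A)
    case empty
    then show ?case using zero by (simp add: tensor_class_def)
  next
    case (insert i A)
    have k1: "Poly_Mapping.keys (\<Sum>i\<in>A. Poly_Mapping.single (T i) (c i)) \<subseteq> tree_monomials ins_generators n"
      by (rule order_trans[OF keys_sum]) (use insert in \<open>auto split: if_splits\<close>)
    have k2: "Poly_Mapping.keys (basis (T i) :: 'k ins_gen tree \<Rightarrow>\<^sub>0 'k) \<subseteq> tree_monomials ins_generators n"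
      using insert by simp
    have IH: "\<phi> n (ins_class n (\<Sum>i\<in>A. Poly_Mapping.single (T i) (c i))) v = tensor_class V n (\<Sum>i\<in>A. scale (c i) (y i))"
      "\<phi> n (ins_class n (basis (T i))) v = tensor_class V n (y i)"
      using insert by auto
    have "\<phi> n (ins_class n (scale (c i) (basis (T i)) + (\<Sum>i\<in>A. Poly_Mapping.single (T i) (c i)))) v
        = (c i \<odot>\<^bsub>tensor_power V n\<^esub> tensor_class V n (y i)) \<oplus>\<^bsub>tensor_power V n\<^esub> tensor_class V n (\<Sum>i\<in>A. scale (c i) (y i))"
      unfolding add[OF order_trans[OF keys_scale k2] k1] smult[OF k2] IH ..
    also have "\<dots> = tensor_class V n (scale (c i) (y i) + (\<Sum>i\<in>A. scale (c i) (y i)))"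
      unfolding tensor_class_def tensor_power_def smult_quotient[OF K] add_quotient[OF K] ..
    finally show ?case using insert by simp
  qed
qed

lemma Ins_coalgebra_zero:
  fixes V :: "('k::field, 'v) module"
  assumes "coalgebra Ins V \<phi>"
  shows "is_zero_space V"
proof -
  have V: "vector_space_on V" and \<phi>: "operad_morphism Ins (Coend V) \<phi>"
    using assms by (auto simp: coalgebra_def)
  interpret Module.module "cring_class_ops :: 'k ring" V by (rule V)
  have "v = \<zero>\<^bsub>V\<^esub>" if v: "v \<in> carrier V" for v
  proof -
    define mu :: "'k ins_gen tree \<Rightarrow>\<^sub>0 'k" where "mu = basis (Node Mu [Leaf 0, Leaf 1])"
    define ups :: "nat \<Rightarrow> 'k ins_gen tree \<Rightarrow>\<^sub>0 'k" where "ups i = basis (Node (Ups i) [])" for i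
    define iv :: "(nat \<Rightarrow>\<^sub>0 'k) \<Rightarrow> 'k ins_gen tree \<Rightarrow>\<^sub>0 'k" where "iv l = basis (Node (Inv l) [Leaf 0])" for l
    define T where "T l i = Node Mu [Node (Ups i) [], Node (Inv l) [Leaf 0]]"
      for l :: "nat \<Rightarrow>\<^sub>0 'k" and i
    have mu_keys: "Poly_Mapping.keys mu \<subseteq> tree_monomials ins_generators 2"
      and ups_keys: "\<And>i. Poly_Mapping.keys (ups i) \<subseteq> tree_monomials ins_generators 0"
      and inv_keys: "\<And>l. l \<noteq> 0 \<Longrightarrow> Poly_Mapping.keys (iv l) \<subseteq> tree_monomials ins_generators 1"
      and T_in: "\<And>l i. l \<noteq> 0 \<Longrightarrow> T l i \<in> tree_monomials ins_generators 1"
      by (auto simp: mu_def ups_def iv_def T_def tree_monomials_def)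
    have lin: "\<phi> n X \<in> linear_maps V (tensor_power V n)" if "X \<in> carrier (op_space Ins n)" for n X
      by (rule coaction_linear[OF \<phi> that])
    \<comment> \<open>One representative of delta(v), fixed before \<open>l\<close> is chosen and
      shared by all the indices i.\<close>
    define r where "r = repr (\<phi> 2 (ins_class 2 mu) v)"
    have "\<phi> 2 (ins_class 2 mu) v \<in> carrier (tensor_power V 2)"
      using lin[of "ins_class 2 mu" 2] coset_in_quotient[OF subspace_ins_ideal mu_keys] v
      by (auto simp: linear_maps_def)
    then have r: "Poly_Mapping.keys r \<subseteq> tuples V 2"
      unfolding r_def tensor_power_def by (rule keys_repr[OF subspace_tensor_kernel[OF V]])
    \<comment> \<open>The form epsilon_i: an element of the zeroth tensor power is a multiple of the
      empty tuple.\<close>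
    define e where "e i a = Poly_Mapping.lookup (repr (\<phi> 0 (ins_class 0 (ups i)) a)) []" for i a
    have "finite (hd ` Poly_Mapping.keys r)" by simp
    \<comment> \<open>The points are the left factors of the terms of \<open>r\<close>; the
      combination of forms given by \<open>l\<close> vanishes at all of them.\<close>
    from ex_nonzero_annihilating[OF this, of 0 e] obtain l where l: "l \<noteq> 0"
      and l_e: "\<And>vs. vs \<in> Poly_Mapping.keys r \<Longrightarrow>
        (\<Sum>i\<in>Poly_Mapping.keys l. Poly_Mapping.lookup l i * e i (hd vs)) = 0"
      by auto
    \<comment> \<open>A representative of I_lambda applied to the right factor.\<close>
    define f where "f vs = repr (\<phi> 1 (ins_class 1 (iv l)) (vs ! 1))" for vs
    \<comment> \<open>A representative of (epsilon_i \<otimes> I_lambda)(delta(v)).\<close>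
    define y where "y i = lin_extend (\<lambda>vs. scale (e i (hd vs)) (f vs)) r" for i
    have T_action: "\<phi> 1 (ins_class 1 (basis (T l i))) v = tensor_class V 1 (y i)" for i
    proof -
      have comp_free: "composable (free_operad ins_generators) [0, 1] mu [ups i, iv l]"
        using mu_keys ups_keys inv_keys[OF l] by (simp add: composable_def numeral_2_eq_2)
      have comp: "composable Ins [0, 1] (ins_class 2 mu) [ins_class 0 (ups i), ins_class 1 (iv l)]"
        using mu_keys ups_keys inv_keys[OF l]
        by (simp add: composable_def numeral_2_eq_2 coset_in_quotient[OF subspace_ins_ideal])
      \<comment> \<open>The first graft has arity 0, so the offset of the second one is 0 and its
        leaf keeps the number 0.\<close>
      have "op_comp (free_operad ins_generators) [0, 1] mu [ups i, iv l] = basis (T l i)"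
        by (simp add: mu_def ups_def iv_def T_def graft_def relabel_def)
      then have T_comp: "ins_class 1 (basis (T l i))
          = op_comp Ins [0, 1] (ins_class 2 mu) [ins_class 0 (ups i), ins_class 1 (iv l)]"
        using op_comp_Ins_class[OF comp_free] by (simp add: numeral_2_eq_2 del: op_comp_free)
      have comp_Coend: "\<phi> 1 (op_comp Ins [0, 1] (ins_class 2 mu) [ins_class 0 (ups i), ins_class 1 (iv l)])
          = op_comp (Coend V) [0, 1] (\<phi> 2 (ins_class 2 mu))
          [\<phi> 0 (ins_class 0 (ups i)), \<phi> 1 (ins_class 1 (iv l))]"
        using operad_morphism_comp[OF \<phi> comp] by (simp add: numeral_2_eq_2)
      have "\<phi> 1 (ins_class 1 (basis (T l i))) v
          = tensor_class V 1 (lin_extend (\<lambda>vs. multilinear_ext concat (map2 (\<lambda>g v. repr (g v))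
              [\<phi> 0 (ins_class 0 (ups i)), \<phi> 1 (ins_class 1 (iv l))] vs)) r)"
        unfolding T_comp comp_Coend using v by (simp add: Coend_def tensor_of_maps_eq r_def)
      also have "lin_extend (\<lambda>vs. multilinear_ext concat (map2 (\<lambda>g v. repr (g v))
              [\<phi> 0 (ins_class 0 (ups i)), \<phi> 1 (ins_class 1 (iv l))] vs)) r = y i"
        unfolding y_def lin_extend_def
      proof (intro sum.cong refl arg_cong[of _ _ "scale _"])
        fix vs assume "vs \<in> Poly_Mapping.keys r"
        then have "vs \<in> tuples V 2" using r by auto
        then obtain a b where vs: "vs = [a, b]" "a \<in> carrier V" "b \<in> carrier V"
          by (auto simp: tuples_def length_Suc_conv numeral_2_eq_2)
        let ?p = "repr (\<phi> 0 (ins_class 0 (ups i)) a)"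
        have "\<phi> 0 (ins_class 0 (ups i)) a \<in> carrier (tensor_power V 0)"
          using lin[of "ins_class 0 (ups i)" 0] coset_in_quotient[OF subspace_ins_ideal ups_keys] vs
          by (auto simp: linear_maps_def)
        then have "Poly_Mapping.keys ?p \<subseteq> tuples V 0"
          unfolding tensor_power_def by (rule keys_repr[OF subspace_tensor_kernel[OF V]])
        then have "?p = Poly_Mapping.single [] (e i a)"
          by (intro poly_mapping_eqI)
             (force simp: e_def lookup_single when_def in_keys_iff tuples_def)
        \<comment> \<open>The left factor contributes only the empty tuple, which concatenation
          absorbs, and its coefficient.\<close>
        then show "multilinear_ext concat (map2 (\<lambda>g v. repr (g v))
              [\<phi> 0 (ins_class 0 (ups i)), \<phi> 1 (ins_class 1 (iv l))] vs) = scale (e i (hd vs)) (f vs)"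
          by (simp add: vs f_def lin_extend_basis)
      qed
      finally show ?thesis .
    qed
    have rel: "ins_inverse_relation l \<in> ins_ideal 1"
      using ideal_generated_by_superset[of ins_relations 1] l by (auto simp: ins_relations_def)
    have v_eq: "tensor_class V 1 (basis [v]) = \<phi> 1 (ins_class 1 (basis (Leaf 0))) v"
      using \<phi> v by (simp add: operad_morphism_def Coend_def pure_tensor_def)
    \<comment> \<open>The relation for \<open>l\<close>, read as two descriptions of the identity
      operation of \<open>Ins\<close>: one acts as the identity on v, the other will be seen to give
      0.\<close>
    have Leaf_eq: "ins_class 1 (basis (Leaf 0))
        = ins_class 1 (\<Sum>i\<in>Poly_Mapping.keys l. Poly_Mapping.single (T l i) (Poly_Mapping.lookup l i))"
      using rel unfolding T_def ins_inverse_relation_def coset_eq_iff[OF subspace_ins_ideal, symmetric] by (rule sym)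
    have "tensor_class V 1 (basis [v]) = tensor_class V 1 (\<Sum>i\<in>Poly_Mapping.keys l. scale (Poly_Mapping.lookup l i) (y i))"
      unfolding v_eq Leaf_eq
      by (rule operad_morphism_Ins_Coend_additive[OF V \<phi> v]) (use T_in[OF l] T_action in auto)
    also have "(\<Sum>i\<in>Poly_Mapping.keys l. scale (Poly_Mapping.lookup l i) (y i)) = 0"
    proof (rule poly_mapping_eqI)
      fix k
      have "Poly_Mapping.lookup (\<Sum>i\<in>Poly_Mapping.keys l. scale (Poly_Mapping.lookup l i) (y i)) k
        = (\<Sum>i\<in>Poly_Mapping.keys l. \<Sum>vs\<in>Poly_Mapping.keys r. Poly_Mapping.lookup l i * e i (hd vs) *
             (Poly_Mapping.lookup r vs * Poly_Mapping.lookup (f vs) k))"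
        by (simp add: y_def lin_extend_def lookup_sum sum_distrib_left ac_simps)
      \<comment> \<open>After exchanging the sums, the inner sum over i is the annihilating
        combination at the left factor; neither the coefficient of \<open>vs\<close> nor
        \<open>f vs\<close> depends on i.\<close>
      also have "\<dots> = (\<Sum>vs\<in>Poly_Mapping.keys r. (\<Sum>i\<in>Poly_Mapping.keys l. Poly_Mapping.lookup l i * e i (hd vs)) *
             (Poly_Mapping.lookup r vs * Poly_Mapping.lookup (f vs) k))"
        by (subst sum.swap) (simp add: sum_distrib_right)
      also have "\<dots> = 0" using l_e by simp
      finally show "Poly_Mapping.lookup (\<Sum>i\<in>Poly_Mapping.keys l. scale (Poly_Mapping.lookup l i) (y i)) k
        = Poly_Mapping.lookup 0 k" by simp
    qed
    finally have "basis [v] \<in> tensor_kernel V 1"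
      by (simp add: tensor_class_def coset_eq_self_iff[OF subspace_tensor_kernel[OF V]])
    then show "v = \<zero>\<^bsub>V\<^esub>" by (rule basis_notin_tensor_kernel[OF V v])
  qed
  then show ?thesis by (auto simp: is_zero_space_def)
qed

section \<open>The zero coalgebra and the comonad\<close>

text \<open>The point \<open>z\<close> is a parameter because an arbitrary type has no distinguished
  element; the cofree coalgebra on W will take the zero of W.\<close>

definition trivial_space :: "'u \<Rightarrow> ('k::field, 'u) module" where
  "trivial_space z = \<lparr>carrier = {z}, monoid.mult = undefined, one = undefined, zero = z,
     add = (\<lambda>_ _. z), module.smult = (\<lambda>_ _. z)\<rparr>"

lemma trivial_space_simps [simp]:
  "carrier (trivial_space z) = {z}" "zero (trivial_space z) = z"
  "x \<oplus>\<^bsub>trivial_space z\<^esub> y = z" "c \<odot>\<^bsub>trivial_space z\<^esub> x = z"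
  by (simp_all add: trivial_space_def)

lemma vector_space_trivial: "vector_space_on (trivial_space z :: ('k::field, 'u) module)"
proof (intro Module.moduleI)
  show "cring (cring_class_ops :: 'k ring)" by (rule cring_class)
  show "abelian_group (trivial_space z :: ('k, 'u) module)"
    by (rule abelian_groupI) auto
qed auto

lemma is_zero_space_trivial: "is_zero_space (trivial_space z)"
  by (simp add: is_zero_space_def)

text \<open>Since 0 = 0 * 0, the image of zero is 0 times itself. Of the target only the law for the
  scalar 0 is assumed, which \<open>tensor_power_simps\<close> provides for tensor powers.\<close>

lemma linear_maps_zero:
  fixes A :: "('k::field, 'a) module"
  assumes "f \<in> linear_maps A B" "vector_space_on A"
    and "\<And>y. y \<in> carrier B \<Longrightarrow> 0 \<odot>\<^bsub>B\<^esub> y = \<zero>\<^bsub>B\<^esub>"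
  shows "f \<zero>\<^bsub>A\<^esub> = \<zero>\<^bsub>B\<^esub>"
proof -
  interpret Module.module "cring_class_ops :: 'k ring" A by (rule assms(2))
  have "\<forall>c. \<forall>x\<in>carrier A. f (c \<odot>\<^bsub>A\<^esub> x) = c \<odot>\<^bsub>B\<^esub> f x"
    using assms(1) by (simp add: linear_maps_def)
  then have "f (0 \<odot>\<^bsub>A\<^esub> \<zero>\<^bsub>A\<^esub>) = 0 \<odot>\<^bsub>B\<^esub> f \<zero>\<^bsub>A\<^esub>" by blast
  moreover have "f \<zero>\<^bsub>A\<^esub> \<in> carrier B" by (rule linear_maps_closed[OF assms(1)]) simp
  moreover have "0 \<odot>\<^bsub>A\<^esub> \<zero>\<^bsub>A\<^esub> = \<zero>\<^bsub>A\<^esub>" using smult_r_null[of 0] by (simp add: carrier_class)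
  ultimately show ?thesis using assms(3) by simp
qed

lemma vector_space_zero_smult:
  fixes B :: "('k::field, 'b) module"
  assumes "vector_space_on B" "y \<in> carrier B"
  shows "0 \<odot>\<^bsub>B\<^esub> y = \<zero>\<^bsub>B\<^esub>"
proof -
  interpret Module.module "cring_class_ops :: 'k ring" B by (rule assms(1))
  show ?thesis using smult_l_null[OF assms(2)] by (simp add: class_simps)
qed

lemma linear_maps_to_zero_space:
  "f \<in> linear_maps A B \<Longrightarrow> is_zero_space B \<Longrightarrow> f = zero_map A B"
  by (auto simp: linear_maps_def zero_map_def is_zero_space_def PiE_def intro!: extensionalityI[of _ "carrier A"])

lemma linear_maps_from_zero_space:
  assumes "f \<in> linear_maps A B" "is_zero_space A" "vector_space_on A"
    and "\<And>y. y \<in> carrier B \<Longrightarrow> 0 \<odot>\<^bsub>B\<^esub> y = \<zero>\<^bsub>B\<^esub>"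
  shows "f = zero_map A B"
  using assms linear_maps_zero[OF assms(1,3,4)]
  by (auto simp: linear_maps_def zero_map_def is_zero_space_def PiE_def intro!: extensionalityI[of _ "carrier A"])

lemma zero_map_linear:
  fixes A :: "('k::field, 'a) module"
  assumes "vector_space_on A" "\<zero>\<^bsub>B\<^esub> \<in> carrier B" "\<zero>\<^bsub>B\<^esub> \<oplus>\<^bsub>B\<^esub> \<zero>\<^bsub>B\<^esub> = \<zero>\<^bsub>B\<^esub>"
    "\<And>c. c \<odot>\<^bsub>B\<^esub> \<zero>\<^bsub>B\<^esub> = \<zero>\<^bsub>B\<^esub>"
  shows "zero_map A B \<in> linear_maps A B"
proof -
  interpret Module.module "cring_class_ops :: 'k ring" A by (rule assms(1))
  show ?thesis using assms by (auto simp: linear_maps_def zero_map_def carrier_class)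
qed

lemma tensor_power_simps:
  assumes "vector_space_on V"
  shows "\<zero>\<^bsub>tensor_power V n\<^esub> = tensor_kernel V n"
    and "tensor_kernel V n \<in> carrier (tensor_power V n)"
    and "tensor_kernel V n \<oplus>\<^bsub>tensor_power V n\<^esub> tensor_kernel V n = tensor_kernel V n"
    and "c \<odot>\<^bsub>tensor_power V n\<^esub> tensor_kernel V n = tensor_kernel V n"
    and "X \<in> carrier (tensor_power V n) \<Longrightarrow> 0 \<odot>\<^bsub>tensor_power V n\<^esub> X = tensor_kernel V n"
    and "x \<in> tensor_kernel V n \<Longrightarrow> tensor_class V n x = tensor_kernel V n"
    and "repr (tensor_kernel V n) \<in> tensor_kernel V n"
  using subspace_tensor_kernel[OF assms, of n] repr_in[of "tensor_kernel V n"]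
    subspaceD(2)[OF subspace_tensor_kernel[OF assms, of n]]
  by (auto simp: tensor_power_def tensor_class_def zero_in_quotient zero_smult_quotient
      coset_eq_self_iff)

text \<open>The restriction to the carrier makes it extensional, as \<open>linear_maps\<close>
  demands.\<close>

abbreviation trivial_coaction :: "('k::field, 'p) operad \<Rightarrow> 'u \<Rightarrow> ('k, 'p, 'u) coaction" where
  "trivial_coaction P z n \<equiv> \<lambda>p\<in>carrier (op_space P n). zero_map (trivial_space z) (tensor_power (trivial_space z) n)"

text \<open>The condition at \<open>n = 0\<close> is there because the zeroth tensor power is the ground field even for
  the zero space.\<close>

lemma tensor_kernel_trivial:
  fixes p :: "'u list \<Rightarrow>\<^sub>0 'k::field"
  assumes "Poly_Mapping.keys p \<subseteq> tuples (trivial_space z :: ('k, 'u) module) n" "n = 0 \<Longrightarrow> p = 0"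
  shows "p \<in> tensor_kernel (trivial_space z) n"
proof (cases n)
  case 0
  then show ?thesis using assms subspaceD(2)[OF subspace_tensor_kernel[OF vector_space_trivial]] by simp
next
  case (Suc m)
  let ?Z = "trivial_space z :: ('k, 'u) module"
  note K = subspace_tensor_kernel[OF vector_space_trivial, of z n]
  let ?z = "replicate n z"
  \<comment> \<open>Since z + z = z, additivity in the first slot gives e - e - e = -e for the only
    basis tuple e.\<close>
  have "basis ([] @ (z \<oplus>\<^bsub>?Z\<^esub> z) # replicate m z) - basis ([] @ z # replicate m z)
      - basis ([] @ z # replicate m z) \<in> multilinear_relations ?Z n"
    unfolding multilinear_relations_def
    by (rule UnI1, rule CollectI, rule exI[of _ "[]"], rule exI[of _ z], rule exI[of _ z], rule exI[of _ "replicate m z"])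
       (auto simp: tuples_def Suc)
  then have "- basis ?z \<in> tensor_kernel ?Z n"
    using span_superset[of "multilinear_relations ?Z n" "free_space (tuples ?Z n)"]
    by (auto simp: tensor_kernel_def Suc)
  then have "basis ?z \<in> tensor_kernel ?Z n" using subspaceD(5)[OF K] by fastforce
  moreover have "t = ?z" if "t \<in> Poly_Mapping.keys p" for t
    using that assms(1) by (auto simp: tuples_def intro!: replicate_eqI)
  ultimately have "lin_extend basis p \<in> tensor_kernel ?Z n"
    by (intro subspace_lin_extend[OF K]) auto
  then show ?thesis by (simp add: lin_extend_basis)
qed

text \<open>The \<open>operad\<close> record carries no axioms, so closure under the operations is
  assumed; it guarantees that the restricted coaction is applied inside its domain. All equations
  then compare zero tensors, and in arity 0 they hold because the chosen representative of zero is 0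
  itself.\<close>

lemma operad_morphism_trivial_coaction:
  fixes z :: 'u and P :: "('k::field, 'p) operad"
  assumes id: "op_id P \<in> carrier (op_space P 1)"
    and add: "\<And>n p q. p \<in> carrier (op_space P n) \<Longrightarrow> q \<in> carrier (op_space P n)
        \<Longrightarrow> p \<oplus>\<^bsub>op_space P n\<^esub> q \<in> carrier (op_space P n)"
    and smult: "\<And>n p c. p \<in> carrier (op_space P n) \<Longrightarrow> c \<odot>\<^bsub>op_space P n\<^esub> p \<in> carrier (op_space P n)"
    and comp: "\<And>ns p qs. composable P ns p qs \<Longrightarrow> op_comp P ns p qs \<in> carrier (op_space P (sum_list ns))"
    and act: "\<And>n \<sigma> p. p \<in> carrier (op_space P n) \<Longrightarrow> \<sigma> permutes {..<n}
        \<Longrightarrow> op_act P n \<sigma> p \<in> carrier (op_space P n)"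
  shows "operad_morphism P (Coend (trivial_space z)) (trivial_coaction P z)"
proof -
  define Z where "Z = (trivial_space z :: ('k, 'u) module)"
  let ?c = "\<lambda>n. \<lambda>p\<in>carrier (op_space P n). zero_map Z (tensor_power Z n)"
  have cZ: "carrier Z = {z}" by (simp add: Z_def)
  have Z: "vector_space_on Z" by (simp add: Z_def vector_space_trivial)
  note K = subspace_tensor_kernel[OF Z]
  note T = tensor_power_simps[OF Z]
  have zm: "zero_map Z (tensor_power Z n) = (\<lambda>v\<in>{z}. tensor_kernel Z n)" for n
    unfolding zero_map_def T(1) by (simp add: cZ)
  have zm_lin: "zero_map Z (tensor_power Z n) \<in> linear_maps Z (tensor_power Z n)" for n
    by (rule zero_map_linear[OF Z]) (simp_all add: T)
  have kernelI: "p \<in> tensor_kernel Z n"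
    if "Poly_Mapping.keys p \<subseteq> tuples Z n" "n = 0 \<Longrightarrow> p = 0" for n p
    using that unfolding Z_def by (rule tensor_kernel_trivial)
  have repr_keys: "Poly_Mapping.keys (repr (tensor_kernel Z n)) \<subseteq> tuples Z n" for n
    by (rule subspaceD(1)[OF K T(7)])
  have repr_0: "repr (tensor_kernel Z 0) = 0"
    using T(7)[of 0] by (simp add: tensor_kernel_0[OF Z])
  have lin: "?c n \<in> linear_maps (op_space P n) (op_space (Coend Z) n)" for n
  proof -
    have "(\<lambda>v\<in>carrier Z. zero_map Z (tensor_power Z n) v \<oplus>\<^bsub>tensor_power Z n\<^esub> zero_map Z (tensor_power Z n) v)
        = zero_map Z (tensor_power Z n)"
      and "(\<lambda>v\<in>carrier Z. c \<odot>\<^bsub>tensor_power Z n\<^esub> zero_map Z (tensor_power Z n) v)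
        = zero_map Z (tensor_power Z n)" for c
      by (auto simp: zm T cZ fun_eq_iff)
    then show ?thesis
      using zm_lin add smult by (auto simp: linear_maps_def[of "op_space P n"] hom_space_def)
  qed
  have comp_eq: "?c (sum_list ns) (op_comp P ns p qs)
      = op_comp (Coend Z) ns (?c (length ns) p) (map2 (?c) ns qs)"
    if c: "composable P ns p qs" for ns p qs
  proof -
    let ?rs = "map (\<lambda>n. repr (tensor_kernel Z n)) ns"
    have len: "length qs = length ns" using c by (auto simp: composable_def dest: list_all2_lengthD)
    have map2: "map2 (?c) ns qs = map (\<lambda>n. zero_map Z (tensor_power Z n)) ns"
      using c by (auto simp: composable_def list_all2_conv_all_nth intro!: nth_equalityI)
    have "lin_extend (\<lambda>vs. multilinear_ext concat
        (map2 (\<lambda>g v. repr (g v)) (map (\<lambda>n. zero_map Z (tensor_power Z n)) ns) vs)) (repr (tensor_kernel Z (length ns)))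
        \<in> tensor_kernel Z (sum_list ns)"
    proof (rule subspace_lin_extend[OF K])
      fix vs assume vs_key: "vs \<in> Poly_Mapping.keys (repr (tensor_kernel Z (length ns)))"
      then have vs: "length vs = length ns" "set vs \<subseteq> {z}"
        using repr_keys[of "length ns"] by (auto simp: tuples_def cZ)
      then have vs_nth: "vs ! i = z" if "i < length ns" for i
        using subsetD[OF vs(2) nth_mem, of i] vs(1) that by simp
      \<comment> \<open>For empty \<open>ns\<close>, \<open>vs\<close> would be a key of the
        representative of zero in arity 0, which is 0 and has no keys.\<close>
      have nonempty: "ns \<noteq> []" using vs_key by (auto simp: repr_0)
      have rs: "map2 (\<lambda>g v. repr (g v)) (map (\<lambda>n. zero_map Z (tensor_power Z n)) ns) vs = ?rs"
        by (rule nth_equalityI) (auto simp: vs vs_nth zm)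
      have "multilinear_ext concat ?rs \<in> tensor_kernel Z (sum_list ns)"
      proof (rule kernelI)
        have "concat ts \<in> tuples Z (sum_list ns)"
          if "ts \<in> listset (map Poly_Mapping.keys ?rs)" for ts
          using that
        proof (induction ns arbitrary: ts)
          case Nil
          then show ?case by (simp add: tuples_def)
        next
          case (Cons n ns)
          then obtain t us where "ts = t # us" "t \<in> tuples Z n" "concat us \<in> tuples Z (sum_list ns)"
            using repr_keys[of n] by (auto simp: set_Cons_def)
          then show ?case by (auto simp: tuples_def)
        qed
        then show "Poly_Mapping.keys (multilinear_ext concat ?rs) \<subseteq> tuples Z (sum_list ns)"
          by (intro order_trans[OF keys_multilinear_ext] image_subsetI)
      next
        \<comment> \<open>All inner arities are then 0, so every argument is represented by the
          vector 0, and there is at least one argument.\<close>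
        assume "sum_list ns = 0"
        then have "0 \<in> set ?rs"
          using nonempty repr_0 by (cases ns) auto
        then show "multilinear_ext concat ?rs = 0" by (rule multilinear_ext_zero)
      qed
      then show "multilinear_ext concat
        (map2 (\<lambda>g v. repr (g v)) (map (\<lambda>n. zero_map Z (tensor_power Z n)) ns) vs) \<in> tensor_kernel Z (sum_list ns)"
        unfolding rs .
    qed
    then have tom: "tensor_of_maps Z ns (map (\<lambda>n. zero_map Z (tensor_power Z n)) ns) (tensor_kernel Z (length ns))
        = tensor_kernel Z (sum_list ns)"
      unfolding tensor_of_maps_eq by (rule T(6))
    have p: "?c (length ns) p = zero_map Z (tensor_power Z (length ns))"
      using c by (simp add: composable_def)
    have "op_comp (Coend Z) ns (?c (length ns) p) (map2 ?c ns qs)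
        = (\<lambda>v\<in>{z}. tensor_of_maps Z ns (map (\<lambda>n. zero_map Z (tensor_power Z n)) ns)
             (zero_map Z (tensor_power Z (length ns)) v))"
      unfolding map2 p by (simp add: Coend_def cZ)
    also have "\<dots> = zero_map Z (tensor_power Z (sum_list ns))"
      unfolding zm[of "sum_list ns"]
    proof (rule restrict_ext)
      fix v assume "v \<in> {z}"
      then have "zero_map Z (tensor_power Z (length ns)) v = tensor_kernel Z (length ns)"
        by (simp add: zm)
      with tom show "tensor_of_maps Z ns (map (\<lambda>n. zero_map Z (tensor_power Z n)) ns)
          (zero_map Z (tensor_power Z (length ns)) v) = tensor_kernel Z (sum_list ns)" by simp
    qed
    finally show ?thesis using comp[OF c] by simp
  qed
  have act_eq: "?c n (op_act P n \<sigma> p) = op_act (Coend Z) n \<sigma> (?c n p)"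
    if p: "p \<in> carrier (op_space P n)" and \<sigma>: "\<sigma> permutes {..<n}" for n \<sigma> p
  proof -
    have "linear_ext (\<lambda>vs. map (\<lambda>i. vs ! \<sigma> i) [0..<n]) (repr (tensor_kernel Z n)) \<in> tensor_kernel Z n"
    proof (rule kernelI)
      have "map (\<lambda>i. vs ! \<sigma> i) [0..<n] \<in> tuples Z n" if "vs \<in> tuples Z n" for vs
        using that permutes_in_image[OF \<sigma>] nth_mem[of _ vs] by (fastforce simp: tuples_def)
      then show "Poly_Mapping.keys (linear_ext (\<lambda>vs. map (\<lambda>i. vs ! \<sigma> i) [0..<n]) (repr (tensor_kernel Z n))) \<subseteq> tuples Z n"
        unfolding linear_ext_eq_lin_extend using repr_keys[of n]
        by (intro order_trans[OF keys_lin_extend]) auto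
    qed (simp add: repr_0 linear_ext_eq_lin_extend)
    then have perm: "tensor_perm Z n \<sigma> (tensor_kernel Z n) = tensor_kernel Z n"
      by (simp add: tensor_perm_def T)
    have "zero_map Z (tensor_power Z n) = (\<lambda>v\<in>{z}. tensor_perm Z n \<sigma> (zero_map Z (tensor_power Z n) v))"
      unfolding zm by (rule restrict_ext) (simp add: perm)
    then show ?thesis
      using act[OF p \<sigma>] p by (simp add: Coend_def cZ)
  qed
  \<comment> \<open>In arity 1 the tensor of z is zero, so the identity operation is correctly sent
    to the zero map.\<close>
  have pure: "pure_tensor Z [z] = tensor_kernel Z 1"
    unfolding pure_tensor_def using kernelI[of "basis [z]" 1] by (simp add: T tuples_def cZ)
  have "zero_map Z (tensor_power Z 1) = (\<lambda>v\<in>{z}. pure_tensor Z [v])"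
    unfolding zm by (rule restrict_ext) (simp add: pure)
  then have "?c 1 (op_id P) = op_id (Coend Z)"
    using id by (simp add: Coend_def cZ)
  with lin comp_eq act_eq have "operad_morphism P (Coend Z) ?c"
    unfolding operad_morphism_def by blast
  then show ?thesis unfolding Z_def .
qed

lemma coalgebra_trivial_Ins: "coalgebra Ins (trivial_space z) (trivial_coaction Ins z)"
  unfolding coalgebra_def
proof (intro conjI vector_space_trivial operad_morphism_trivial_coaction)
  show "op_id Ins \<in> carrier (op_space Ins 1)"
    unfolding op_id_Ins op_space_Ins
    by (rule coset_in_quotient[OF subspace_ins_ideal]) (simp add: Leaf_in_tree_monomials)
qed (auto simp: add_closed_quotient[OF subspace_ins_ideal] smult_closed_quotient[OF subspace_ins_ideal]
      op_comp_Ins_closed[unfolded op_space_Ins] op_act_Ins_closed[unfolded op_space_Ins])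

text \<open>Every vector of \<open>X\<close> is zero, so both sides of the compatibility are the
  zero tensor; in arity 0 its representative is 0, and 0 is mapped to 0.\<close>

lemma zero_map_coalgebra_morphism:
  fixes P :: "('k::field, 'p) operad" and X :: "('k, 'u) module" and z :: 'v
  assumes X: "coalgebra P X \<xi>" "is_zero_space X"
  shows "zero_map X (trivial_space z) \<in> coalgebra_morphisms P X \<xi> (trivial_space z) (trivial_coaction P z)"
proof -
  let ?Z = "trivial_space z :: ('k, 'v) module"
  let ?f = "zero_map X ?Z"
  have VX: "vector_space_on X" and \<xi>: "operad_morphism P (Coend X) \<xi>" using X by (auto simp: coalgebra_def)
  note TX = tensor_power_simps[OF VX] and TZ = tensor_power_simps[OF vector_space_trivial]
  have "trivial_coaction P z n p (?f v) = tensor_power_map ?Z n ?f (\<xi> n p v)"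
    if p: "p \<in> carrier (op_space P n)" and v: "v \<in> carrier X" for n p v
  proof -
    have "v = \<zero>\<^bsub>X\<^esub>" using v X(2) by (simp add: is_zero_space_def)
    then have \<xi>_v: "\<xi> n p v = tensor_kernel X n"
      using linear_maps_zero[OF coaction_linear[OF \<xi> p] VX] by (simp add: TX)
    let ?r = "repr (tensor_kernel X n)"
    have keys: "Poly_Mapping.keys ?r \<subseteq> tuples X n"
      by (rule subspaceD(1)[OF subspace_tensor_kernel[OF VX] TX(7)])
    have "linear_ext (map ?f) ?r \<in> tensor_kernel ?Z n"
    proof (rule tensor_kernel_trivial)
      have "map ?f vs \<in> tuples ?Z n" if "vs \<in> tuples X n" for vs
        using that by (auto simp: tuples_def zero_map_def)
      then show "Poly_Mapping.keys (linear_ext (map ?f) ?r) \<subseteq> tuples ?Z n"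
        unfolding linear_ext_eq_lin_extend using keys
        by (intro order_trans[OF keys_lin_extend]) auto
      assume "n = 0"
      then have "?r = 0" using TX(7)[of 0] by (simp add: tensor_kernel_0[OF VX])
      then show "linear_ext (map ?f) ?r = 0" by (simp add: linear_ext_eq_lin_extend)
    qed
    then have "tensor_power_map ?Z n ?f (\<xi> n p v) = tensor_kernel ?Z n"
      by (simp add: tensor_power_map_def \<xi>_v TZ)
    moreover have "trivial_coaction P z n p (?f v) = tensor_kernel ?Z n"
      using p v by (simp add: zero_map_def TZ)
    ultimately show ?thesis by simp
  qed
  moreover have "?f \<in> linear_maps X ?Z" by (rule zero_map_linear[OF VX]) simp_all
  ultimately show ?thesis by (simp add: coalgebra_morphisms_def)
qed

section \<open>The zero right adjoint and the comonad of an arbitrary right adjoint\<close>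

definition trivial_cofree :: "('k::field, 'p) operad \<Rightarrow> ('k, 'p, 'u) cofree_functor" where
  "trivial_cofree P = \<lparr>cofree_space = (\<lambda>W. trivial_space \<zero>\<^bsub>W\<^esub>),
     cofree_coaction = (\<lambda>W. trivial_coaction P \<zero>\<^bsub>W\<^esub>),
     cofree_counit = (\<lambda>W. zero_map (trivial_space \<zero>\<^bsub>W\<^esub>) W)\<rparr>"

text \<open>As all coalgebras vanish, each linear map f from one is zero; the zero map lifts it, and
  no other linear map into the zero space exists.\<close>

lemma right_adjoint_trivial_cofree:
  fixes P :: "('k::field, 'p) operad"
  assumes zero: "\<And>(X :: ('k, 'u) module) \<xi>. coalgebra P X \<xi> \<Longrightarrow> is_zero_space X"
    and triv: "\<And>z :: 'u. coalgebra P (trivial_space z) (trivial_coaction P z)"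
  shows "right_adjoint_to_forgetful P (trivial_cofree P :: ('k, 'p, 'u) cofree_functor)"
  unfolding right_adjoint_to_forgetful_def
proof (intro allI impI conjI)
  fix W :: "('k, 'u) module" assume W: "vector_space_on W"
  let ?R = "trivial_cofree P :: ('k, 'p, 'u) cofree_functor"
  interpret W: Module.module "cring_class_ops :: 'k ring" W by (rule W)
  show "coalgebra P (cofree_space ?R W) (cofree_coaction ?R W)"
    using triv by (simp add: trivial_cofree_def)
  show "cofree_counit ?R W \<in> linear_maps (cofree_space ?R W) W"
    using W.smult_r_null by (simp add: trivial_cofree_def zero_map_linear[OF vector_space_trivial] carrier_class)
  fix X :: "('k, 'u) module" and \<xi> f assume *: "coalgebra P X \<xi> \<and> f \<in> linear_maps X W"
  then have X: "vector_space_on X" "is_zero_space X" using zero by (auto simp: coalgebra_def)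
  let ?g = "zero_map X (trivial_space \<zero>\<^bsub>W\<^esub> :: ('k, 'u) module)"
  have "f = zero_map X W"
    using linear_maps_from_zero_space * X vector_space_zero_smult[OF W] by blast
  then have "?g \<in> colifts P ?R W X \<xi> f"
    using zero_map_coalgebra_morphism[of P X \<xi>] * X(2)
    by (auto simp: colifts_def trivial_cofree_def zero_map_def)
  moreover have "g = ?g" if "g \<in> colifts P ?R W X \<xi> f" for g
  proof -
    have "g \<in> linear_maps X (trivial_space \<zero>\<^bsub>W\<^esub>)"
      using that by (simp add: colifts_def trivial_cofree_def coalgebra_morphisms_def)
    then show ?thesis using is_zero_space_trivial by (rule linear_maps_to_zero_space)
  qed
  ultimately show "\<exists>!g. g \<in> colifts P ?R W X \<xi> f" by blast
qed

text \<open>Holds for every right adjoint and not just for \<open>trivial_cofree\<close>: cofree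
  coalgebras are coalgebras, hence zero, and all the structure maps start from them.\<close>

lemma is_zero_comonad_associated:
  fixes P :: "('k::field, 'p) operad" and R :: "('k, 'p, 'u) cofree_functor"
  assumes zero: "\<And>(X :: ('k, 'u) module) \<xi>. coalgebra P X \<xi> \<Longrightarrow> is_zero_space X"
    and R: "right_adjoint_to_forgetful P R"
  shows "is_zero_comonad (associated_comonad P R)"
  unfolding is_zero_comonad_def
proof (intro allI impI conjI)
  have C: "coalgebra P (cofree_space R W) (cofree_coaction R W)"
      "vector_space_on (cofree_space R W)" "is_zero_space (cofree_space R W)"
      "cofree_counit R W \<in> linear_maps (cofree_space R W) W"
      if "vector_space_on W" for W
    using R that zero unfolding right_adjoint_to_forgetful_def coalgebra_def by blast+
  \<comment> \<open>The universal property makes the description by \<open>THE\<close> denote an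
    actual lift, that is, a linear map into a zero space.\<close>
  have lift: "(THE g. g \<in> colifts P R W' X \<xi> f) = zero_map X (cofree_space R W')"
    if "vector_space_on W'" "coalgebra P X \<xi>" "f \<in> linear_maps X W'" for W' X \<xi> f
  proof -
    have "\<exists>!g. g \<in> colifts P R W' X \<xi> f"
      using R that unfolding right_adjoint_to_forgetful_def by blast
    then have "(THE g. g \<in> colifts P R W' X \<xi> f) \<in> colifts P R W' X \<xi> f" by (rule theI')
    then have "(THE g. g \<in> colifts P R W' X \<xi> f) \<in> linear_maps X (cofree_space R W')"
      by (simp add: colifts_def coalgebra_morphisms_def)
    then show ?thesis using C(3)[OF that(1)] by (rule linear_maps_to_zero_space)
  qed
  fix W :: "('k, 'u) module" assume W: "vector_space_on W"
  let ?A = "cofree_space R W"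
  interpret A: Module.module "cring_class_ops :: 'k ring" ?A by (rule C(2)[OF W])
  show "is_zero_space (com_obj (associated_comonad P R) W)"
    using C(3)[OF W] by (simp add: associated_comonad_def)
  show "com_counit (associated_comonad P R) W = zero_map (com_obj (associated_comonad P R) W) W"
    using linear_maps_from_zero_space[OF C(4)[OF W] C(3)[OF W] C(2)[OF W] vector_space_zero_smult[OF W]]
    by (simp add: associated_comonad_def)
  have "(\<lambda>x\<in>carrier ?A. x) \<in> linear_maps ?A ?A"
    by (auto simp: linear_maps_def carrier_class)
  then show "com_comult (associated_comonad P R) W
      = zero_map (com_obj (associated_comonad P R) W)
          (com_obj (associated_comonad P R) (com_obj (associated_comonad P R) W))"
    using lift[OF C(2)[OF W] C(1)[OF W]] by (simp add: associated_comonad_def)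
  fix W' :: "('k, 'u) module" and h :: "'u \<Rightarrow> 'u" assume *: "vector_space_on W' \<and> h \<in> linear_maps W W'"
  have "compose (carrier ?A) h (cofree_counit R W) \<in> linear_maps ?A W'"
    using C(4)[OF W] conjunct2[OF *]
    by (auto simp: linear_maps_def compose_def carrier_class PiE_iff)
  then show "com_map (associated_comonad P R) W W' h
      = zero_map (com_obj (associated_comonad P R) W) (com_obj (associated_comonad P R) W')"
    using lift[OF conjunct1[OF *] C(1)[OF W]] by (simp add: associated_comonad_def)
qed

text \<open>The existence of a right adjoint is part of the claim so that the assertion about
  comonads is not vacuous.\<close>

theorem mainTheorem1:
  shows "\<not> is_zero_operad (Ins :: ('k::field, ('k ins_gen tree \<Rightarrow>\<^sub>0 'k) set) operad)
    \<and> (\<forall>(V :: ('k, 'u) module) \<phi>. coalgebra Ins V \<phi> \<longrightarrow> is_zero_space V)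
    \<and> (\<exists>R :: ('k, ('k ins_gen tree \<Rightarrow>\<^sub>0 'k) set, 'u) cofree_functor.
          right_adjoint_to_forgetful Ins R)
    \<and> (\<forall>R :: ('k, ('k ins_gen tree \<Rightarrow>\<^sub>0 'k) set, 'u) cofree_functor.
          right_adjoint_to_forgetful Ins R \<longrightarrow> is_zero_comonad (associated_comonad Ins R))"
proof (intro conjI allI impI)
  show "\<not> is_zero_operad (Ins :: ('k, ('k ins_gen tree \<Rightarrow>\<^sub>0 'k) set) operad)"
    by (rule Ins_nonzero)
  show zero: "is_zero_space V" if "coalgebra Ins V \<phi>" for V :: "('k, 'u) module" and \<phi>
    using that by (rule Ins_coalgebra_zero)
  show "\<exists>R :: ('k, ('k ins_gen tree \<Rightarrow>\<^sub>0 'k) set, 'u) cofree_functor. right_adjoint_to_forgetful Ins R"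
    by (rule exI, rule right_adjoint_trivial_cofree[OF _ coalgebra_trivial_Ins]) (rule zero)
  show "is_zero_comonad (associated_comonad Ins R)" if "right_adjoint_to_forgetful Ins R"
    for R :: "('k, ('k ins_gen tree \<Rightarrow>\<^sub>0 'k) set, 'u) cofree_functor"
    using zero that by (rule is_zero_comonad_associated)
qed

end
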